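(* Let $n\ge 3$ and let $C_n$ be a vertex-weighted oriented cycle with vertex set $\{x_1,\ldots,x_n\}$, edges $x_1x_2,\ x_2x_3,\ \ldots,\ x_{n-1}x_n,\ x_nx_1$ (each directed from the first vertex to the second), and weights $w(x_i)\geq 2$ for all $1\leq i\leq n$. Let $s\ge 1$, and for $1\leq j\leq s$ let $T_j=(V(T_j),E(T_j),w_j)$ be a vertex-weighted rooted tree such that every non-root vertex $x$ of $T_j$ with degree $d(x)\neq 1$ has weight $w_j(x)\geq 2$. Let $D=C_n\cup\bigl(\bigcup_{j=1}^{s}T_j\bigr)$ be the vertex-weighted oriented graph obtained by attaching, for each $1\leq j\leq s$, the root of $T_j$ to the vertex $x_{i_j}$ of the cycle $C_n$, where $1\le i_1<i_2<\cdots<i_s\le n$. Let $w$ denote the weight function of $D$. Then \begin{enumerate} \item $\operatorname{reg}(I(D))=\sum_{x\in V(D)}w(x)-|E(D)|+1$, \item $\operatorname{pd}(I(D))=|E(D)|-1$. \end{enumerate}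
   Context: A vertex-weighted oriented graph is a triplet $D=(V(D),E(D),w)$ where $(V(D),E(D))$ is a finite simple graph (the underlying graph) together with an orientation of each edge, and $w:V(D)\to\mathbb{N}^{+}=\{1,2,\ldots\}$ is a weight function. The directed edge from $u$ to $v$ is written $uv$. The degree $d(x)$ of a vertex is its degree in the underlying undirected graph. A source is a vertex having only arrows leaving it; by convention every source has weight $1$ (this does not affect the ideal below). If $V(D)=\{v_1,\ldots,v_N\}$, let $S=k[v_1,\ldots,v_N]$ be the polynomial ring over a field $k$ whose variables are the vertices. The edge ideal of $D$ is $$I(D)=\bigl(v_a v_b^{\,w(v_b)} \mid v_av_b\in E(D)\bigr)\subset S.$$ A rooted tree is an oriented tree (an orientation of an undirected tree) with a distinguished vertex, the root, such that all edges are oriented away from the root. Attaching the root of $T_j$ to $x_{i_j}$ means identifying the root of $T_j$ with the vertex $x_{i_j}$; the trees $T_j$ are otherwise pairwise vertex-disjoint and disjoint from $C_n$. In $D$, the vertex $x_{i_j}$ carries its weight from $C_n$, and each non-root vertex of $T_j$ carries its weight from $T_j$. Edge orientations are those of $C_n$ and of the $T_j$. For a homogeneous ideal $I\subset S$ with graded Betti numbers $\beta_{i,j}(I)$ (from the graded minimal free resolution of $I$ as an $S$-module, with the minimal generators in homological degree $0$), $\operatorname{reg}(I)=\max\{j-i\mid \beta_{i,j}(I)\neq 0\}$ and $\operatorname{pd}(I)=\max\{i\mid \beta_{i,j}(I)\neq 0 \text{ for some } j\}$. *)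

theory Defs
  imports
    "HOL-Library.Poly_Mapping"
    "Graph_Theory.Digraph_Component"
    "Jordan_Normal_Form.Matrix"
begin

section \<open>Vertex-weighted oriented graphs\<close>

text \<open>A vertex without incoming arcs is a source, so an isolated vertex is one as well.\<close>

definition source :: "'v pair_pre_digraph \<Rightarrow> 'v \<Rightarrow> bool" where
  "source G v \<longleftrightarrow> v \<in> pverts G \<and> in_arcs (with_proj G) v = {}"

text \<open>
  The locale \<open>pair_digraph\<close> provides finiteness and the absence of loops. Together with
  asymmetry this says that the arcs are an orientation of a finite simple graph.
\<close>

locale weighted_oriented_graph = pair_digraph G
  for G :: "'v pair_pre_digraph" and w :: "'v \<Rightarrow> nat" +
  assumes oriented: "(u, v) \<in> parcs G \<Longrightarrow> (v, u) \<notin> parcs G"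
    and weight_pos: "v \<in> pverts G \<Longrightarrow> 1 \<le> w v"
    and source_weight: "source G v \<Longrightarrow> w v = 1"

abbreviation underlying :: "'v pair_pre_digraph \<Rightarrow> ('v, 'v \<times> 'v) pre_digraph" where
  "underlying G \<equiv> with_proj (mk_symmetric (with_proj G))"

definition vertex_degree :: "'v pair_pre_digraph \<Rightarrow> 'v \<Rightarrow> nat" where
  "vertex_degree G v = out_degree (underlying G) v"

text \<open>
  The constant \<open>Digraph_Component.tree\<close> only excludes \<^emph>\<open>directed\<close> cycles and so is not
  the notion needed here. In the underlying symmetric digraph every edge yields closed walks of
  length 2, which \<open>pre_digraph.cycle\<close> accepts; the bound on the length excludes these.
\<close>

definition oriented_tree :: "'v pair_pre_digraph \<Rightarrow> bool" where
  "oriented_tree G \<longleftrightarrow> connected (with_proj G) \<and>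
     \<not> (\<exists>p. pre_digraph.cycle (underlying G) p \<and> 3 \<le> length p)"

text \<open>
  An arc \<open>(u, v)\<close> is oriented away from the root if the path from the root to \<open>v\<close> in the
  underlying tree (unique, as this is a tree) has \<open>(u, v)\<close> as its last step.
\<close>

definition rooted_tree :: "'v pair_pre_digraph \<Rightarrow> 'v \<Rightarrow> bool" where
  "rooted_tree G r \<longleftrightarrow> oriented_tree G \<and> r \<in> pverts G \<and>
     (\<forall>(u, v) \<in> parcs G. \<exists>p. pre_digraph.apath (underlying G) r (p @ [(u, v)]) v)"


section \<open>Polynomial rings and edge ideals\<close>

type_synonym ('v, 'k) mpoly = "('v \<Rightarrow>\<^sub>0 nat) \<Rightarrow>\<^sub>0 'k"

definition poly_ring :: "'v set \<Rightarrow> ('v, 'k::field) mpoly set" where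
  "poly_ring V = {p. \<forall>m \<in> Poly_Mapping.keys p. Poly_Mapping.keys m \<subseteq> V}"

definition var :: "'v \<Rightarrow> ('v, 'k::field) mpoly" where
  "var v = Poly_Mapping.single (Poly_Mapping.single v 1) 1"

definition monomial_degree :: "('v \<Rightarrow>\<^sub>0 nat) \<Rightarrow> nat" where
  "monomial_degree m = (\<Sum>v \<in> Poly_Mapping.keys m. Poly_Mapping.lookup m v)"

definition generated_ideal ::
    "'v set \<Rightarrow> ('v, 'k::field) mpoly set \<Rightarrow> ('v, 'k) mpoly set" where
  "generated_ideal V B =
     {\<Sum>b \<in> A. c b * b | A c. finite A \<and> A \<subseteq> B \<and> c ` A \<subseteq> poly_ring V}"

definition edge_ideal ::
    "'v pair_pre_digraph \<Rightarrow> ('v \<Rightarrow> nat) \<Rightarrow> ('v, 'k::field) mpoly set" where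
  "edge_ideal G w = generated_ideal (pverts G) {var a * var b ^ w b | a b. (a, b) \<in> parcs G}"


section \<open>Graded minimal free resolutions\<close>

definition free_module :: "'v set \<Rightarrow> nat \<Rightarrow> ('v, 'k::field) mpoly vec set" where
  "free_module V r = {f \<in> carrier_vec r. \<forall>i < r. f $ i \<in> poly_ring V}"

text \<open>
  A list \<open>ds\<close> of degrees stands for the graded free module with one basis element of degree
  \<open>d\<close>, i.e. one summand \<open>S(-d)\<close>, for each entry \<open>d\<close>. The matrix of a homogeneous map of degree
  0 from the module of \<open>ds\<close> to that of \<open>es\<close> has at position \<open>(a, b)\<close> a homogeneous polynomial of
  degree \<open>ds ! b - es ! a\<close>, which is 0 if this difference is negative.
\<close>

definition graded_map ::
    "'v set \<Rightarrow> nat list \<Rightarrow> nat list \<Rightarrow> ('v, 'k::field) mpoly mat \<Rightarrow> bool" where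
  "graded_map V ds es M \<longleftrightarrow> M \<in> carrier_mat (length es) (length ds) \<and>
     (\<forall>a < length es. \<forall>b < length ds. M $$ (a, b) \<in> poly_ring V \<and>
        (\<forall>m \<in> Poly_Mapping.keys (M $$ (a, b)). monomial_degree m + es ! a = ds ! b))"

definition map_image ::
    "'v set \<Rightarrow> ('v, 'k::field) mpoly mat \<Rightarrow> ('v, 'k) mpoly vec set" where
  "map_image V M = (\<lambda>f. M *\<^sub>v f) ` free_module V (dim_col M)"

definition map_kernel ::
    "'v set \<Rightarrow> ('v, 'k::field) mpoly mat \<Rightarrow> ('v, 'k) mpoly vec set" where
  "map_kernel V M = {f \<in> free_module V (dim_col M). M *\<^sub>v f = 0\<^sub>v (dim_row M)}"

text \<open>
  The field \<open>shifts\<close> gives the degrees of the basis of each \<open>F i\<close>. The matrix \<open>boundary 0\<close>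
  is that of the augmentation from \<open>F 0\<close> to the ideal inside \<open>S\<close>, and
  \<open>boundary (Suc i)\<close> is that of the differential from \<open>F (Suc i)\<close> to \<open>F i\<close>.
\<close>

record (overloaded) ('v, 'k) graded_complex =
  shifts :: "nat \<Rightarrow> nat list"
  boundary :: "nat \<Rightarrow> (('v \<Rightarrow>\<^sub>0 nat) \<Rightarrow>\<^sub>0 'k) mat"

definition graded_free_resolution ::
    "'v set \<Rightarrow> ('v, 'k::field) mpoly set \<Rightarrow> ('v, 'k) graded_complex \<Rightarrow> bool" where
  "graded_free_resolution V I F \<longleftrightarrow>
     graded_map V (shifts F 0) [0] (boundary F 0) \<and>
     (\<forall>i. graded_map V (shifts F (Suc i)) (shifts F i) (boundary F (Suc i))) \<and>
     map_image V (boundary F 0) = (\<lambda>p. vec 1 (\<lambda>_. p)) ` I \<and>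
     (\<forall>i. map_kernel V (boundary F i) = map_image V (boundary F (Suc i)))"

text \<open>
  Minimality: each differential maps \<open>F (Suc i)\<close> into \<open>\<mm> F i\<close>, where \<open>\<mm>\<close> is the
  ideal of polynomials with zero constant term. The augmentation is not constrained.
\<close>

definition minimal_graded_free_resolution ::
    "'v set \<Rightarrow> ('v, 'k::field) mpoly set \<Rightarrow> ('v, 'k) graded_complex \<Rightarrow> bool" where
  "minimal_graded_free_resolution V I F \<longleftrightarrow> graded_free_resolution V I F \<and>
     (\<forall>i. \<forall>f \<in> map_image V (boundary F (Suc i)).
        \<forall>l < length (shifts F i). Poly_Mapping.lookup (f $ l) 0 = 0)"

definition graded_betti ::
    "'v set \<Rightarrow> ('v, 'k::field) mpoly set \<Rightarrow> nat \<Rightarrow> nat \<Rightarrow> nat" where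
  "graded_betti V I i j =
     (THE b. \<exists>F. minimal_graded_free_resolution V I F \<and> b = count_list (shifts F i) j)"

definition regularity :: "'v set \<Rightarrow> ('v, 'k::field) mpoly set \<Rightarrow> int" where
  "regularity V I = Max {int j - int i | i j. graded_betti V I i j \<noteq> 0}"

definition projective_dimension :: "'v set \<Rightarrow> ('v, 'k::field) mpoly set \<Rightarrow> nat" where
  "projective_dimension V I = Max {i. \<exists>j. graded_betti V I i j \<noteq> 0}"

end

theory Submission
  imports Defs "Jordan_Normal_Form.Determinant"
begin

text \<open>
  Every vertex of \<open>D\<close> has exactly one incoming arc: on the cycle its predecessor is the tail, and
  in a rooted tree every vertex except the root has a unique parent, while the root receives its
  arc from the cycle. So the generators of \<open>I(D)\<close> are indexed by the vertices: \<open>v\<close> with parent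
  \<open>p(v)\<close> gives the product of \<open>p(v)\<close> and \<open>v^w(v)\<close>. In any other generator, \<open>v\<close> occurs with exponent
  at most 1, and not at all if \<open>v\<close> has no children. A vertex with a child lies on the cycle or is a
  non-root vertex of degree at least 2 in its tree; in both cases its weight is at least 2. Hence
  leaving out the generator of \<open>v\<close> from any set of generators lowers the exponent of \<open>v\<close> in their
  least common multiple.

  This is exactly the condition under which the Taylor resolution of a monomial ideal is minimal
  (\<open>taylor_resolution_minimal\<close>). Its basis in homological degree \<open>i\<close> consists of the sets of \<open>i +
  1\<close> generators, each in the degree of its least common multiple. With \<open>N = |V(D)| = |E(D)|\<close>
  generators the projective dimension is therefore \<open>N - 1\<close>. For the regularity, adding a generator
  to a set raises the homological degree by 1 and the degree of the least common multiple by at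
  least 1, so the maximum is attained at the set of all generators, whose least common multiple is
  the product of all \<open>v^w(v)\<close> (\<open>regularity_and_pd_of_strict_lcms\<close>).

  Two general facts carry this. Graded Betti numbers can be read off from any minimal graded free
  resolution (\<open>graded_betti_eq_count\<close>): two such resolutions are homotopy equivalent by maps of
  degree 0, and modulo the ideal generated by the variables the boundary maps vanish, and with them
  all null-homotopic maps, so that the comparison maps become inverse matrices that respect
  degrees. The Taylor complex is exact (\<open>taylor_resolution\<close>): in each multidegree it is the chain
  complex of a full simplex, for which coning with a vertex is a contracting homotopy.
\<close>

section \<open>Polynomials and their graded parts\<close>

lemma mult_eq_sum_single:
  fixes p q :: "'a::monoid_add \<Rightarrow>\<^sub>0 'b::semiring_0"
  shows "p * q = (\<Sum>a\<in>Poly_Mapping.keys p. \<Sum>b\<in>Poly_Mapping.keys q.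
     Poly_Mapping.single (a + b) (Poly_Mapping.lookup p a * Poly_Mapping.lookup q b))"
proof -
  have sum_single: "r = (\<Sum>a\<in>Poly_Mapping.keys r. Poly_Mapping.single a (Poly_Mapping.lookup r a))"
    for r :: "'a \<Rightarrow>\<^sub>0 'b"
    by (rule poly_mapping_eqI)
      (simp add: lookup_sum lookup_single when_def in_keys_iff)
  have "p * q = (\<Sum>a\<in>Poly_Mapping.keys p. Poly_Mapping.single a (Poly_Mapping.lookup p a)) *
      (\<Sum>b\<in>Poly_Mapping.keys q. Poly_Mapping.single b (Poly_Mapping.lookup q b))"
    using sum_single[of p] sum_single[of q] by simp
  then show ?thesis by (simp add: sum_product mult_single)
qed

lemma lookup_mult_eq_sum:
  fixes p q :: "'a::monoid_add \<Rightarrow>\<^sub>0 'b::semiring_0"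
  shows "Poly_Mapping.lookup (p * q) k = (\<Sum>a\<in>Poly_Mapping.keys p. \<Sum>b\<in>Poly_Mapping.keys q.
     (Poly_Mapping.lookup p a * Poly_Mapping.lookup q b when a + b = k))"
  by (subst mult_eq_sum_single) (simp add: lookup_sum lookup_single)

lemma monomial_add_eq_0_iff:
  fixes a b :: "'v \<Rightarrow>\<^sub>0 nat"
  shows "a + b = 0 \<longleftrightarrow> a = 0 \<and> b = 0"
  by (auto simp: poly_mapping_eq_iff fun_eq_iff lookup_add)

text \<open>Exponents are natural numbers, so a product of two monomials is constant only if both are.\<close>

lemma constant_term_mult:
  fixes p q :: "('v, 'k::field) mpoly"
  shows "Poly_Mapping.lookup (p * q) 0 = Poly_Mapping.lookup p 0 * Poly_Mapping.lookup q 0"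
proof -
  have "Poly_Mapping.lookup (p * q) 0 = (\<Sum>a\<in>Poly_Mapping.keys p. \<Sum>b\<in>Poly_Mapping.keys q.
     (if b = 0 then (Poly_Mapping.lookup p a * Poly_Mapping.lookup q b when a = 0) else 0))"
    unfolding lookup_mult_eq_sum
    by (intro sum.cong refl) (simp add: when_def monomial_add_eq_0_iff)
  also have "\<dots> = (\<Sum>a\<in>Poly_Mapping.keys p. if a = 0
        then Poly_Mapping.lookup p a * Poly_Mapping.lookup q 0 else 0)"
    by (intro sum.cong refl) (simp add: when_def in_keys_iff)
  also have "\<dots> = Poly_Mapping.lookup p 0 * Poly_Mapping.lookup q 0"
    by (simp add: in_keys_iff)
  finally show ?thesis .
qed

lemma monomial_degree_eq_sum:
  assumes "finite A" "Poly_Mapping.keys m \<subseteq> A"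
  shows "monomial_degree m = (\<Sum>v\<in>A. Poly_Mapping.lookup m v)"
  unfolding monomial_degree_def using assms
  by (intro sum.mono_neutral_left) (auto simp: in_keys_iff)

lemma monomial_degree_add: "monomial_degree (a + b) = monomial_degree a + monomial_degree b"
proof -
  let ?A = "Poly_Mapping.keys a \<union> Poly_Mapping.keys b"
  have "monomial_degree (a + b) = (\<Sum>v\<in>?A. Poly_Mapping.lookup (a + b) v)"
    by (intro monomial_degree_eq_sum keys_add) simp
  then show ?thesis
    using monomial_degree_eq_sum[of ?A a] monomial_degree_eq_sum[of ?A b]
    by (simp add: lookup_add sum.distrib)
qed

lemma monomial_degree_0 [simp]: "monomial_degree 0 = 0"
  by (simp add: monomial_degree_def)

lemma keys_add_monomial:
  "Poly_Mapping.keys (a + b :: 'v \<Rightarrow>\<^sub>0 nat) = Poly_Mapping.keys a \<union> Poly_Mapping.keys b"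
  by (auto simp: in_keys_iff lookup_add)

lemma poly_ring_0 [simp]: "0 \<in> poly_ring V"
  and poly_ring_1 [simp]: "1 \<in> poly_ring V"
  by (auto simp: poly_ring_def)

lemma poly_ring_add [intro]: "p \<in> poly_ring V \<Longrightarrow> q \<in> poly_ring V \<Longrightarrow> p + q \<in> poly_ring V"
  using keys_add[of p q] by (fastforce simp: poly_ring_def)

lemma poly_ring_uminus [intro]: "p \<in> poly_ring V \<Longrightarrow> - p \<in> poly_ring V"
  by (auto simp: poly_ring_def in_keys_iff)

lemma poly_ring_diff [intro]: "p \<in> poly_ring V \<Longrightarrow> q \<in> poly_ring V \<Longrightarrow> p - q \<in> poly_ring V"
  using poly_ring_add[of p V "- q"] by auto

lemma poly_ring_mult [intro]: "p \<in> poly_ring V \<Longrightarrow> q \<in> poly_ring V \<Longrightarrow> p * q \<in> poly_ring V"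
  using keys_mult[of p q] by (fastforce simp: poly_ring_def keys_add_monomial)

lemma poly_ring_sum [intro]: "(\<And>i. i \<in> A \<Longrightarrow> p i \<in> poly_ring V) \<Longrightarrow> sum p A \<in> poly_ring V"
  by (induction A rule: infinite_finite_induct) auto

text \<open>The part of \<open>p\<close> that lies in degree \<open>d\<close> of the module \<open>S(-e)\<close>. The condition is an addition
  so that it also expresses that this part is 0 if \<open>d < e\<close>.\<close>

definition graded_part :: "nat \<Rightarrow> nat \<Rightarrow> ('v, 'k::field) mpoly \<Rightarrow> ('v, 'k) mpoly" where
  "graded_part e d p = Poly_Mapping.mapp (\<lambda>m c. c when monomial_degree m + e = d) p"

lemma lookup_graded_part:
  "Poly_Mapping.lookup (graded_part e d p) m =
     (Poly_Mapping.lookup p m when monomial_degree m + e = d)"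
  by (auto simp: graded_part_def lookup_mapp when_def in_keys_iff)

lemma keys_graded_part:
  "Poly_Mapping.keys (graded_part e d p) = {m \<in> Poly_Mapping.keys p. monomial_degree m + e = d}"
  by (auto simp: in_keys_iff lookup_graded_part)

lemma graded_part_in_poly_ring: "p \<in> poly_ring V \<Longrightarrow> graded_part e d p \<in> poly_ring V"
  by (auto simp: poly_ring_def keys_graded_part)

lemma graded_part_sum: "graded_part e d (sum p A) = (\<Sum>i\<in>A. graded_part e d (p i))"
  by (rule poly_mapping_eqI) (simp add: lookup_graded_part lookup_sum when_def)

lemma graded_part_idem:
  "(\<And>m. m \<in> Poly_Mapping.keys p \<Longrightarrow> monomial_degree m + e = d) \<Longrightarrow> graded_part e d p = p"
  by (rule poly_mapping_eqI) (auto simp: lookup_graded_part when_def in_keys_iff)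

text \<open>A homogeneous \<open>q\<close> that maps \<open>S(-e')\<close> to \<open>S(-e)\<close> in degree 0 commutes with taking graded
  parts, because degrees add under multiplication.\<close>

lemma graded_part_mult:
  assumes "\<And>m. m \<in> Poly_Mapping.keys q \<Longrightarrow> monomial_degree m + e = e'"
  shows "graded_part e d (q * p) = q * graded_part e' d p"
proof (rule poly_mapping_eqI)
  fix k
  have "Poly_Mapping.lookup (q * graded_part e' d p) k =
     (\<Sum>a\<in>Poly_Mapping.keys q. \<Sum>b\<in>Poly_Mapping.keys (graded_part e' d p).
     (Poly_Mapping.lookup q a * Poly_Mapping.lookup p b when a + b = k))"
    unfolding lookup_mult_eq_sum
    by (intro sum.cong refl) (auto simp: lookup_graded_part keys_graded_part)
  also have "\<dots> = (\<Sum>a\<in>Poly_Mapping.keys q. \<Sum>b\<in>Poly_Mapping.keys p.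
     if monomial_degree b + e' = d
     then (Poly_Mapping.lookup q a * Poly_Mapping.lookup p b when a + b = k) else 0)"
    unfolding keys_graded_part by (rule sum.cong[OF refl], rule sum.inter_filter) simp
  also have "\<dots> = (\<Sum>a\<in>Poly_Mapping.keys q. \<Sum>b\<in>Poly_Mapping.keys p.
     if monomial_degree k + e = d
     then (Poly_Mapping.lookup q a * Poly_Mapping.lookup p b when a + b = k) else 0)"
    using assms by (intro sum.cong refl) (fastforce simp: when_def monomial_degree_add)
  also have "\<dots> = Poly_Mapping.lookup (graded_part e d (q * p)) k"
    by (cases "monomial_degree k + e = d") (simp_all add: lookup_graded_part lookup_mult_eq_sum)
  finally show "Poly_Mapping.lookup (graded_part e d (q * p)) k =
     Poly_Mapping.lookup (q * graded_part e' d p) k" ..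
qed

section \<open>Homogeneous maps of graded free modules\<close>

lemma graded_map_carrier: "graded_map V ds es M \<Longrightarrow> M \<in> carrier_mat (length es) (length ds)"
  by (simp add: graded_map_def)

lemma graded_mapD:
  assumes "graded_map V ds es M" "a < length es" "b < length ds"
  shows "M $$ (a, b) \<in> poly_ring V"
    and "m \<in> Poly_Mapping.keys (M $$ (a, b)) \<Longrightarrow> monomial_degree m + es ! a = ds ! b"
  using assms by (auto simp: graded_map_def)

lemma mult_mat_entry:
  assumes "A \<in> carrier_mat n r" "B \<in> carrier_mat r m" "i < n" "j < m"
  shows "(A * B) $$ (i, j) = (\<Sum>k<r. A $$ (i, k) * B $$ (k, j))"
  using assms by (auto simp: scalar_prod_def atLeast0LessThan intro!: sum.cong)

lemma mult_mat_vec_entry: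
  assumes "A \<in> carrier_mat n r" "f \<in> carrier_vec r" "i < n"
  shows "(A *\<^sub>v f) $ i = (\<Sum>k<r. A $$ (i, k) * f $ k)"
  using assms by (auto simp: scalar_prod_def atLeast0LessThan intro!: sum.cong)

lemma graded_map_mult:
  assumes M: "graded_map V ds es M" and N: "graded_map V cs ds N"
  shows "graded_map V cs es (M * N)"
  unfolding graded_map_def
proof (intro conjI allI impI ballI)
  note cM = graded_map_carrier[OF M] and cN = graded_map_carrier[OF N]
  show "M * N \<in> carrier_mat (length es) (length cs)" using cM cN by simp
  fix a b assume ab: "a < length es" "b < length cs"
  note e = mult_mat_entry[OF cM cN ab]
  show "(M * N) $$ (a, b) \<in> poly_ring V"
    unfolding e using ab graded_mapD(1)[OF M] graded_mapD(1)[OF N] by blast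
  fix m assume "m \<in> Poly_Mapping.keys ((M * N) $$ (a, b))"
  then obtain k where k: "k < length ds" "m \<in> Poly_Mapping.keys (M $$ (a, k) * N $$ (k, b))"
    unfolding e using keys_sum by (metis (no_types, lifting) UN_E lessThan_iff subsetD)
  then obtain m1 m2 where "m = m1 + m2" "m1 \<in> Poly_Mapping.keys (M $$ (a, k))"
      "m2 \<in> Poly_Mapping.keys (N $$ (k, b))"
    using keys_mult by blast
  then show "monomial_degree m + es ! a = cs ! b"
    using graded_mapD(2)[OF M ab(1) k(1)] graded_mapD(2)[OF N k(1) ab(2)]
    by (fastforce simp: monomial_degree_add)
qed

lemma graded_map_diff:
  assumes M: "graded_map V ds es M" and N: "graded_map V ds es N"
  shows "graded_map V ds es (M - N)"
  using assms unfolding graded_map_def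
  by (auto intro!: poly_ring_diff simp: in_keys_iff lookup_minus)
    (metis diff_self in_keys_iff)

lemma graded_map_one: "graded_map V ds ds (1\<^sub>m (length ds))"
  by (auto simp: graded_map_def)

text \<open>A preimage of a homogeneous element need not be homogeneous, but its graded part of the
  right degree is again a preimage. So a map into an image lifts to a map of degree 0.\<close>

lemma graded_lift:
  assumes M: "graded_map V ds es M" and N: "graded_map V cs es N"
    and im: "\<And>b. b < length cs \<Longrightarrow> col N b \<in> map_image V M"
  shows "\<exists>P. graded_map V cs ds P \<and> M * P = N"
proof -
  note cM = graded_map_carrier[OF M] and cN = graded_map_carrier[OF N]
  have "\<exists>f. f \<in> free_module V (length ds) \<and> M *\<^sub>v f = col N b" if "b < length cs" for b
    using im[OF that] cM by (auto simp: map_image_def)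
  then obtain f where f: "\<And>b. b < length cs \<Longrightarrow> f b \<in> free_module V (length ds)"
      "\<And>b. b < length cs \<Longrightarrow> M *\<^sub>v f b = col N b"
    by metis
  define P where "P = mat (length ds) (length cs) (\<lambda>(k, b). graded_part (ds ! k) (cs ! b) (f b $ k))"
  have cP: "P \<in> carrier_mat (length ds) (length cs)" by (simp add: P_def)
  have "graded_map V cs ds P"
    using f(1) by (auto simp: graded_map_def P_def free_module_def keys_graded_part
        intro!: graded_part_in_poly_ring)
  moreover have "M * P = N"
  proof (rule eq_matI)
    fix a b assume ab': "a < dim_row N" "b < dim_col N"
    then have ab: "a < length es" "b < length cs" using cN by auto
    have fb: "f b \<in> carrier_vec (length ds)" using f(1) ab by (auto simp: free_module_def)
    have "(M * P) $$ (a, b) =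
        (\<Sum>k<length ds. M $$ (a, k) * graded_part (ds ! k) (cs ! b) (f b $ k))"
      unfolding mult_mat_entry[OF cM cP ab] using ab by (simp add: P_def)
    also have "\<dots> = (\<Sum>k<length ds. graded_part (es ! a) (cs ! b) (M $$ (a, k) * f b $ k))"
      using graded_mapD(2)[OF M ab(1)] by (intro sum.cong refl graded_part_mult[symmetric]) auto
    also have "\<dots> = graded_part (es ! a) (cs ! b) ((M *\<^sub>v f b) $ a)"
      by (simp add: mult_mat_vec_entry[OF cM fb ab(1)] graded_part_sum)
    also have "\<dots> = N $$ (a, b)"
      using f(2)[OF ab(2)] ab ab' graded_mapD(2)[OF N ab] by (simp add: graded_part_idem)
    finally show "(M * P) $$ (a, b) = N $$ (a, b)" .
  qed (use cM cN cP in auto)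
  ultimately show ?thesis by blast
qed

lemma col_in_map_kernel:
  assumes M: "graded_map V ds es M" and N: "graded_map V cs ds N"
    and 0: "M * N = 0\<^sub>m (length es) (length cs)" and b: "b < length cs"
  shows "col N b \<in> map_kernel V M"
proof -
  note cM = graded_map_carrier[OF M] and cN = graded_map_carrier[OF N]
  have "col N b \<in> free_module V (length ds)"
    using graded_mapD(1)[OF N] cN b by (auto simp: free_module_def)
  moreover have "M *\<^sub>v col N b = col (M * N) b"
    using cM cN b by (auto simp: mult_mat_vec_def)
  ultimately show ?thesis
    using 0 b cM by (auto simp: map_kernel_def)
qed

lemma col_in_map_image:
  assumes M: "graded_map V ds es M" and b: "b < length ds"
  shows "col M b \<in> map_image V M"
proof -
  note cM = graded_map_carrier[OF M]
  have "unit_vec (length ds) b \<in> free_module V (length ds)"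
    using b by (auto simp: free_module_def unit_vec_def)
  moreover have "M *\<^sub>v unit_vec (length ds) b = col M b"
    using cM b by (auto simp: scalar_prod_right_unit)
  ultimately show ?thesis using cM unfolding map_image_def by (metis carrier_matD(2) imageI)
qed

lemma mult_eq_0_if_image_in_kernel:
  assumes M: "graded_map V ds es M" and N: "graded_map V cs ds N"
    and im: "map_image V N \<subseteq> map_kernel V M"
  shows "M * N = 0\<^sub>m (length es) (length cs)"
proof (rule eq_matI)
  note cM = graded_map_carrier[OF M] and cN = graded_map_carrier[OF N]
  fix a b assume "a < dim_row (0\<^sub>m (length es) (length cs) :: ('a, 'b) mpoly mat)"
    "b < dim_col (0\<^sub>m (length es) (length cs) :: ('a, 'b) mpoly mat)"
  then have ab: "a < length es" "b < length cs" by auto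
  have "M *\<^sub>v col N b = 0\<^sub>v (length es)"
    using im col_in_map_image[OF N ab(2)] cM by (auto simp: map_kernel_def)
  then have "(M *\<^sub>v col N b) $ a = 0" using ab by simp
  then show "(M * N) $$ (a, b) = 0\<^sub>m (length es) (length cs) $$ (a, b)"
    using ab cM cN by simp
qed (use graded_map_carrier[OF M] graded_map_carrier[OF N] in auto)

section \<open>Uniqueness of minimal graded free resolutions\<close>

lemma minus_zero_mat:
  fixes A :: "'a::group_add mat"
  assumes "A \<in> carrier_mat n m"
  shows "A - 0\<^sub>m n m = A"
  using assms by (intro eq_matI) auto

lemma diff_eq_0_mat_iff:
  fixes A :: "'a::group_add mat"
  assumes "A \<in> carrier_mat n m" "B \<in> carrier_mat n m"
  shows "A - B = 0\<^sub>m n m \<longleftrightarrow> A = B"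
proof
  assume *: "A - B = 0\<^sub>m n m"
  show "A = B"
  proof (rule eq_matI)
    fix i j assume ij: "i < dim_row B" "j < dim_col B"
    have "(A - B) $$ (i, j) = 0" unfolding * using assms ij by simp
    then show "A $$ (i, j) = B $$ (i, j)" using assms ij by simp
  qed (use assms in auto)
qed (use assms in auto)

lemma resolutionD:
  assumes "graded_free_resolution V I F"
  shows "graded_map V (shifts F 0) [0] (boundary F 0)"
    and "graded_map V (shifts F (Suc i)) (shifts F i) (boundary F (Suc i))"
    and "map_image V (boundary F 0) = (\<lambda>p. vec 1 (\<lambda>_. p)) ` I"
    and "map_kernel V (boundary F i) = map_image V (boundary F (Suc i))"
  using assms by (simp_all add: graded_free_resolution_def)

text \<open>The degrees of the target of \<open>boundary F i\<close>. The augmentation \<open>boundary F 0\<close> ends in the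
  ring, which is free on one element of degree 0.\<close>

definition lower_shifts :: "('v, 'k::field) graded_complex \<Rightarrow> nat \<Rightarrow> nat list" where
  "lower_shifts F i = (case i of 0 \<Rightarrow> [0] | Suc j \<Rightarrow> shifts F j)"

lemma lower_shifts_simps [simp]:
  "lower_shifts F 0 = [0]" "lower_shifts F (Suc i) = shifts F i"
  by (simp_all add: lower_shifts_def)

lemma resolution_boundary:
  "graded_free_resolution V I F \<Longrightarrow> graded_map V (shifts F i) (lower_shifts F i) (boundary F i)"
  by (cases i) (simp_all add: resolutionD)

lemma resolution_boundary_carrier:
  "graded_free_resolution V I F \<Longrightarrow>
     boundary F i \<in> carrier_mat (length (lower_shifts F i)) (length (shifts F i))"
  by (rule graded_map_carrier[OF resolution_boundary])

lemma boundary_boundary: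
  assumes "graded_free_resolution V I F"
  shows "boundary F i * boundary F (Suc i) =
    0\<^sub>m (length (lower_shifts F i)) (length (shifts F (Suc i)))"
  using mult_eq_0_if_image_in_kernel[OF resolution_boundary resolutionD(2)] resolutionD(4) assms
  by blast

text \<open>By exactness, a map that the boundary kills has its columns in the next image.\<close>

lemma lift_into_kernel:
  assumes F: "graded_free_resolution V I F" and N: "graded_map V cs (shifts F i) N"
    and 0: "boundary F i * N = 0\<^sub>m (length (lower_shifts F i)) (length cs)"
  shows "\<exists>P. graded_map V cs (shifts F (Suc i)) P \<and> boundary F (Suc i) * P = N"
  by (rule graded_lift[OF resolutionD(2)[OF F] N])
    (use col_in_map_kernel[OF resolution_boundary[OF F] N 0] resolutionD(4)[OF F] in blast)

text \<open>The comparison theorem. Each \<open>\<phi> (i + 1)\<close> is a lift of \<open>\<phi> i * boundary F (i + 1)\<close>. That this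
  product has its image in a kernel follows from the commutation in the step before; it is the
  invariant of the construction.\<close>

lemma chain_map_exists:
  assumes F: "graded_free_resolution V I F" and G: "graded_free_resolution V I G"
  shows "\<exists>\<phi>. (\<forall>i. graded_map V (shifts F i) (shifts G i) (\<phi> i)) \<and>
    boundary G 0 * \<phi> 0 = boundary F 0 \<and>
    (\<forall>i. boundary G (Suc i) * \<phi> (Suc i) = \<phi> i * boundary F (Suc i))"
proof -
  note cF = resolution_boundary_carrier[OF F] and cG = resolution_boundary_carrier[OF G]
  define P where "P i \<phi> \<longleftrightarrow> graded_map V (shifts F i) (shifts G i) \<phi> \<and>
      (i = 0 \<longrightarrow> boundary G 0 * \<phi> = boundary F 0) \<and>
      boundary G i * (\<phi> * boundary F (Suc i)) =
        0\<^sub>m (length (lower_shifts G i)) (length (shifts F (Suc i)))" for i \<phi>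
  have base: "\<exists>\<phi>. P 0 \<phi>"
  proof -
    have "col (boundary F 0) b \<in> map_image V (boundary G 0)" if "b < length (shifts F 0)" for b
      using col_in_map_image[OF resolutionD(1)[OF F] that] resolutionD(3)[OF F] resolutionD(3)[OF G]
      by simp
    then obtain \<phi> where \<phi>: "graded_map V (shifts F 0) (shifts G 0) \<phi>"
        "boundary G 0 * \<phi> = boundary F 0"
      using graded_lift[OF resolutionD(1)[OF G] resolutionD(1)[OF F]] by blast
    have "boundary G 0 * (\<phi> * boundary F (Suc 0)) = boundary F 0 * boundary F (Suc 0)"
      using assoc_mult_mat[OF cG[of 0] graded_map_carrier[OF \<phi>(1)] cF[of "Suc 0", simplified]] \<phi>(2)
      by simp
    then show ?thesis using \<phi> boundary_boundary[OF F, of 0] by (auto simp: P_def)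
  qed
  have step: "\<exists>\<psi>. P (Suc i) \<psi> \<and> boundary G (Suc i) * \<psi> = \<phi> * boundary F (Suc i)"
    if "P i \<phi>" for i \<phi>
  proof -
    have \<phi>: "graded_map V (shifts F i) (shifts G i) \<phi>"
      "boundary G i * (\<phi> * boundary F (Suc i)) =
        0\<^sub>m (length (lower_shifts G i)) (length (shifts F (Suc i)))"
      using that by (auto simp: P_def)
    obtain \<psi> where \<psi>: "graded_map V (shifts F (Suc i)) (shifts G (Suc i)) \<psi>"
        "boundary G (Suc i) * \<psi> = \<phi> * boundary F (Suc i)"
      using lift_into_kernel[OF G graded_map_mult[OF \<phi>(1) resolutionD(2)[OF F]] \<phi>(2)] by blast
    note c\<phi> = graded_map_carrier[OF \<phi>(1)] and c\<psi> = graded_map_carrier[OF \<psi>(1)]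
    have "boundary G (Suc i) * (\<psi> * boundary F (Suc (Suc i))) =
        \<phi> * (boundary F (Suc i) * boundary F (Suc (Suc i)))"
      using assoc_mult_mat[OF cG[of "Suc i"] c\<psi> cF[of "Suc (Suc i)", simplified]]
        assoc_mult_mat[OF c\<phi> cF[of "Suc i", simplified] cF[of "Suc (Suc i)", simplified]] \<psi>(2)
      by simp
    also have "\<dots> = 0\<^sub>m (length (shifts G i)) (length (shifts F (Suc (Suc i))))"
      using boundary_boundary[OF F, of "Suc i"] c\<phi> by simp
    finally show ?thesis using \<psi> by (auto simp: P_def)
  qed
  obtain \<phi> where \<phi>: "\<And>i. P i (\<phi> i)"
      "\<And>i. boundary G (Suc i) * \<phi> (Suc i) = \<phi> i * boundary F (Suc i)"
    using dependent_nat_choice[of P "\<lambda>i \<phi> \<psi>. boundary G (Suc i) * \<psi> = \<phi> * boundary F (Suc i)",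
        OF base step]
    by auto
  show ?thesis using \<phi> by (intro exI[of _ \<phi>]) (auto simp: P_def)
qed

text \<open>A chain map that induces zero on the resolved module is null-homotopic: if \<open>h i\<close> is found,
  the boundary kills \<open>e (i + 1) - h i * boundary F (i + 1)\<close>, so that this difference lifts to \<open>h (i
  + 1)\<close>.\<close>

lemma null_homotopy_exists:
  assumes F: "graded_free_resolution V I F"
    and e: "\<And>i. graded_map V (shifts F i) (shifts F i) (e i)"
    and e0: "boundary F 0 * e 0 = 0\<^sub>m 1 (length (shifts F 0))"
    and comm: "\<And>i. boundary F (Suc i) * e (Suc i) = e i * boundary F (Suc i)"
  shows "\<exists>h. (\<forall>i. graded_map V (shifts F i) (shifts F (Suc i)) (h i)) \<and>
    boundary F 1 * h 0 = e 0 \<and>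
    (\<forall>i. boundary F (Suc (Suc i)) * h (Suc i) = e (Suc i) - h i * boundary F (Suc i))"
proof -
  note cF = resolution_boundary_carrier[OF F]
  note ce = graded_map_carrier[OF e]
  define P where "P i h \<longleftrightarrow> graded_map V (shifts F i) (shifts F (Suc i)) h \<and>
      (i = 0 \<longrightarrow> boundary F 1 * h = e 0) \<and>
      boundary F (Suc i) * (e (Suc i) - h * boundary F (Suc i)) =
        0\<^sub>m (length (shifts F i)) (length (shifts F (Suc i)))" for i h
  \<comment> \<open>The base case is \<open>r = 0\<close>; in the inductive step \<open>r\<close> is the previous homotopy composed with
    the boundary.\<close>
  have next_step: "P i h" if h: "graded_map V (shifts F i) (shifts F (Suc i)) h"
      and r: "r \<in> carrier_mat (length (shifts F i)) (length (shifts F i))"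
        "r * boundary F (Suc i) = 0\<^sub>m (length (shifts F i)) (length (shifts F (Suc i)))"
      and bh: "boundary F (Suc i) * h = e i - r" and 0: "i = 0 \<Longrightarrow> boundary F 1 * h = e 0"
    for i h r
  proof -
    note ch = graded_map_carrier[OF h]
    note cB = cF[of "Suc i", simplified]
    have "boundary F (Suc i) * (e (Suc i) - h * boundary F (Suc i)) =
       e i * boundary F (Suc i) - boundary F (Suc i) * h * boundary F (Suc i)"
      using mult_minus_distrib_mat[OF cB ce[of "Suc i"] mult_carrier_mat[OF ch cB]] comm[of i]
        assoc_mult_mat[OF cB ch cB] by simp
    also have "\<dots> = e i * boundary F (Suc i) - (e i * boundary F (Suc i) - r * boundary F (Suc i))"
      using minus_mult_distrib_mat[OF ce[of i] r(1) cB] bh by simp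
    also have "\<dots> = 0\<^sub>m (length (shifts F i)) (length (shifts F (Suc i)))"
      unfolding r(2) using mult_carrier_mat[OF ce[of i] cB] by auto
    finally show ?thesis using h 0 by (auto simp: P_def)
  qed
  have base: "\<exists>h. P 0 h"
  proof -
    obtain h where h: "graded_map V (shifts F 0) (shifts F (Suc 0)) h"
        "boundary F (Suc 0) * h = e 0"
      using lift_into_kernel[OF F e, of 0] e0 by auto
    show ?thesis
      using next_step[OF h(1), of "0\<^sub>m (length (shifts F 0)) (length (shifts F 0))"] h(2)
        cF[of "Suc 0"] ce[of 0] minus_zero_mat[OF ce[of 0]] by auto
  qed
  have step: "\<exists>h'. P (Suc i) h' \<and> boundary F (Suc (Suc i)) * h' = e (Suc i) - h * boundary F (Suc i)"
    if "P i h" for i h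
  proof -
    have h: "graded_map V (shifts F i) (shifts F (Suc i)) h"
      "boundary F (Suc i) * (e (Suc i) - h * boundary F (Suc i)) =
        0\<^sub>m (length (shifts F i)) (length (shifts F (Suc i)))"
      using that by (auto simp: P_def)
    note hb = graded_map_mult[OF h(1) resolutionD(2)[OF F]]
    obtain h' where h': "graded_map V (shifts F (Suc i)) (shifts F (Suc (Suc i))) h'"
        "boundary F (Suc (Suc i)) * h' = e (Suc i) - h * boundary F (Suc i)"
      using lift_into_kernel[OF F graded_map_diff[OF e hb]] h(2) by auto
    have "h * boundary F (Suc i) * boundary F (Suc (Suc i)) =
        0\<^sub>m (length (shifts F (Suc i))) (length (shifts F (Suc (Suc i))))"
      using assoc_mult_mat[OF graded_map_carrier[OF h(1)] cF[of "Suc i", simplified]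
          cF[of "Suc (Suc i)", simplified]] boundary_boundary[OF F, of "Suc i"]
        graded_map_carrier[OF h(1)] by simp
    from next_step[OF h'(1) graded_map_carrier[OF hb] this h'(2)] h'(2)
    show ?thesis by auto
  qed
  obtain h where h: "\<And>i. P i (h i)"
      "\<And>i. boundary F (Suc (Suc i)) * h (Suc i) = e (Suc i) - h i * boundary F (Suc i)"
    using dependent_nat_choice[of P
        "\<lambda>i h h'. boundary F (Suc (Suc i)) * h' = e (Suc i) - h * boundary F (Suc i)", OF base step]
    by auto
  show ?thesis using h by (intro exI[of _ h]) (auto simp: P_def)
qed

text \<open>Reduction of a matrix modulo the ideal generated by the variables.\<close>

definition constant_part :: "('v, 'k::field) mpoly mat \<Rightarrow> 'k mat" where
  "constant_part M = map_mat (\<lambda>p. Poly_Mapping.lookup p 0) M"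

lemma constant_part_carrier [simp]:
  "constant_part M \<in> carrier_mat n m \<longleftrightarrow> M \<in> carrier_mat n m"
  by (auto simp: constant_part_def)

lemma constant_part_mult:
  assumes "A \<in> carrier_mat n r" "B \<in> carrier_mat r m"
  shows "constant_part (A * B) = constant_part A * constant_part B"
proof (rule eq_matI)
  have c: "constant_part A \<in> carrier_mat n r" "constant_part B \<in> carrier_mat r m" using assms by auto
  fix i j assume "i < dim_row (constant_part A * constant_part B)"
    "j < dim_col (constant_part A * constant_part B)"
  then have ij: "i < n" "j < m" using assms by (auto simp: constant_part_def)
  show "constant_part (A * B) $$ (i, j) = (constant_part A * constant_part B) $$ (i, j)"
    unfolding mult_mat_entry[OF c ij] using assms ij
    by (simp add: constant_part_def mult_mat_entry[OF assms ij] lookup_sum constant_term_mult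
      del: index_mult_mat(1))
qed (use assms in \<open>auto simp: constant_part_def\<close>)

lemma constant_part_diff:
  assumes "A \<in> carrier_mat n m" "B \<in> carrier_mat n m"
  shows "constant_part (A - B) = constant_part A - constant_part B"
  using assms by (intro eq_matI) (auto simp: constant_part_def lookup_minus)

lemma constant_part_one: "constant_part (1\<^sub>m n) = 1\<^sub>m n"
  by (intro eq_matI) (auto simp: constant_part_def lookup_one)

text \<open>The columns of a boundary matrix are the images of the basis elements.\<close>

lemma constant_part_boundary:
  assumes F: "minimal_graded_free_resolution V I F"
  shows "constant_part (boundary F (Suc i)) = 0\<^sub>m (length (shifts F i)) (length (shifts F (Suc i)))"
proof (rule eq_matI)
  have res: "graded_free_resolution V I F"
    using F by (simp add: minimal_graded_free_resolution_def)
  note c = resolution_boundary_carrier[OF res, of "Suc i", simplified]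
  fix a b assume "a < dim_row (0\<^sub>m (length (shifts F i)) (length (shifts F (Suc i))) :: 'b mat)"
    "b < dim_col (0\<^sub>m (length (shifts F i)) (length (shifts F (Suc i))) :: 'b mat)"
  then have ab: "a < length (shifts F i)" "b < length (shifts F (Suc i))" by auto
  have "Poly_Mapping.lookup (col (boundary F (Suc i)) b $ a) 0 = 0"
    using F col_in_map_image[OF resolutionD(2)[OF res] ab(2)] ab(1)
    unfolding minimal_graded_free_resolution_def by blast
  then show "constant_part (boundary F (Suc i)) $$ (a, b) =
      0\<^sub>m (length (shifts F i)) (length (shifts F (Suc i))) $$ (a, b)"
    using ab c by (simp add: constant_part_def)
next
  have res: "graded_free_resolution V I F"
    using F by (simp add: minimal_graded_free_resolution_def)
  note c = resolution_boundary_carrier[OF res, of "Suc i", simplified]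
  show "dim_row (constant_part (boundary F (Suc i))) =
      dim_row (0\<^sub>m (length (shifts F i)) (length (shifts F (Suc i))) :: 'b mat)"
    "dim_col (constant_part (boundary F (Suc i))) =
      dim_col (0\<^sub>m (length (shifts F i)) (length (shifts F (Suc i))) :: 'b mat)"
    using c by (auto simp: constant_part_def)
qed

text \<open>Since all boundary maps vanish modulo the maximal ideal, so does a null-homotopic map.\<close>

lemma constant_part_null_homotopic:
  assumes F: "minimal_graded_free_resolution V I F"
    and e: "\<And>i. graded_map V (shifts F i) (shifts F i) (e i)"
    and e0: "boundary F 0 * e 0 = 0\<^sub>m 1 (length (shifts F 0))"
    and comm: "\<And>i. boundary F (Suc i) * e (Suc i) = e i * boundary F (Suc i)"
  shows "constant_part (e i) = 0\<^sub>m (length (shifts F i)) (length (shifts F i))"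
proof -
  have res: "graded_free_resolution V I F"
    using F by (simp add: minimal_graded_free_resolution_def)
  obtain h where h: "\<And>i. graded_map V (shifts F i) (shifts F (Suc i)) (h i)"
      "boundary F 1 * h 0 = e 0"
      "\<And>i. boundary F (Suc (Suc i)) * h (Suc i) = e (Suc i) - h i * boundary F (Suc i)"
    using null_homotopy_exists[OF res e e0 comm] by blast
  note ch = graded_map_carrier[OF h(1)] and ce = graded_map_carrier[OF e]
  note cB = resolution_boundary_carrier[OF res, of "Suc _", simplified]
  have bh: "constant_part (boundary F (Suc j) * h j) = 0\<^sub>m (length (shifts F j)) (length (shifts F j))" for j
    using constant_part_mult[OF cB ch] constant_part_boundary[OF F] ch[of j] by simp
  show ?thesis
  proof (cases i)
    case 0
    then show ?thesis using bh[of 0] h(2) by simp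
  next
    case (Suc j)
    let ?n = "length (shifts F (Suc j))"
    have hb: "constant_part (h j * boundary F (Suc j)) = 0\<^sub>m ?n ?n"
      using constant_part_mult[OF ch[of j] cB] constant_part_boundary[OF F] ch[of j] by simp
    have "constant_part (e (Suc j)) - 0\<^sub>m ?n ?n = 0\<^sub>m ?n ?n"
      using bh[of "Suc j"] hb constant_part_diff[OF ce[of "Suc j"] mult_carrier_mat[OF ch[of j] cB]]
      unfolding h(3) by simp
    moreover have "constant_part (e (Suc j)) \<in> carrier_mat ?n ?n" using ce[of "Suc j"] by simp
    ultimately show ?thesis unfolding Suc by (simp add: minus_zero_mat)
  qed
qed

lemma left_invertible_rows_le_cols:
  fixes A :: "'k::field mat"
  assumes A: "A \<in> carrier_mat r s" and B: "B \<in> carrier_mat s r" and AB: "A * B = 1\<^sub>m r"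
  shows "r \<le> s"
proof (rule ccontr)
  assume "\<not> r \<le> s"
  \<comment> \<open>Padding with zeros gives square matrices with product 1, one of which has a zero column.\<close>
  define A' where "A' = mat r r (\<lambda>(i, j). if j < s then A $$ (i, j) else 0)"
  define B' where "B' = mat r r (\<lambda>(i, j). if i < s then B $$ (i, j) else 0)"
  have c: "A' \<in> carrier_mat r r" "B' \<in> carrier_mat r r" by (auto simp: A'_def B'_def)
  have "A' * B' = 1\<^sub>m r"
  proof (rule eq_matI)
    fix i j assume "i < dim_row (1\<^sub>m r :: 'k mat)" "j < dim_col (1\<^sub>m r :: 'k mat)"
    then have ij: "i < r" "j < r" by auto
    have "(A' * B') $$ (i, j) = (\<Sum>k<r. if k < s then A $$ (i, k) * B $$ (k, j) else 0)"
      unfolding mult_mat_entry[OF c ij] using ij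
      by (intro sum.cong refl) (auto simp: A'_def B'_def)
    also have "\<dots> = (\<Sum>k<s. A $$ (i, k) * B $$ (k, j))"
      using \<open>\<not> r \<le> s\<close> by (intro sum.mono_neutral_cong_right) auto
    also have "\<dots> = 1\<^sub>m r $$ (i, j)"
      using mult_mat_entry[OF A B ij] AB by simp
    finally show "(A' * B') $$ (i, j) = 1\<^sub>m r $$ (i, j)" .
  qed (use c in auto)
  then have "B' * A' = 1\<^sub>m r" by (rule mat_mult_left_right_inverse[OF c])
  moreover have "(B' * A') $$ (s, s) = 0"
    using \<open>\<not> r \<le> s\<close> mult_mat_entry[OF c(2,1), of s s] by (simp add: A'_def)
  ultimately show False using \<open>\<not> r \<le> s\<close> by simp
qed

lemma count_list_eq_length_filter_positions:
  "count_list xs j = length (filter (\<lambda>a. xs ! a = j) [0..<length xs])"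
proof -
  have "count_list (map ((!) xs) [0..<length xs]) j = length (filter (\<lambda>a. j = xs ! a) [0..<length xs])"
    by (simp add: count_list_eq_length_filter filter_map o_def del: map_nth)
  moreover have "(\<lambda>a. j = xs ! a) = (\<lambda>a. xs ! a = j)" by auto
  ultimately show ?thesis unfolding map_nth by simp
qed

text \<open>If the matrices preserve degrees, the rows and columns of one degree form blocks that are
  again one-sided inverses of each other.\<close>

lemma count_le_if_graded_left_inverse:
  fixes A :: "'k::field mat"
  assumes A: "A \<in> carrier_mat (length ds) (length es)"
    and B: "B \<in> carrier_mat (length es) (length ds)" and AB: "A * B = 1\<^sub>m (length ds)"
    and deg: "\<And>a b. a < length ds \<Longrightarrow> b < length es \<Longrightarrow> A $$ (a, b) \<noteq> 0 \<Longrightarrow> ds ! a = es ! b"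
  shows "count_list ds j \<le> count_list es j"
proof -
  define la where "la = filter (\<lambda>a. ds ! a = j) [0..<length ds]"
  define lb where "lb = filter (\<lambda>b. es ! b = j) [0..<length es]"
  have la: "distinct la" "set la = {a. a < length ds \<and> ds ! a = j}"
    and lb: "distinct lb" "set lb = {b. b < length es \<and> es ! b = j}"
    by (auto simp: la_def lb_def)
  have la_nth: "la ! p < length ds \<and> ds ! (la ! p) = j" if "p < length la" for p
    using la(2) nth_mem[OF that] by auto
  define A' where "A' = mat (length la) (length lb) (\<lambda>(p, q). A $$ (la ! p, lb ! q))"
  define B' where "B' = mat (length lb) (length la) (\<lambda>(q, p). B $$ (lb ! q, la ! p))"
  have c: "A' \<in> carrier_mat (length la) (length lb)" "B' \<in> carrier_mat (length lb) (length la)"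
    by (auto simp: A'_def B'_def)
  have "A' * B' = 1\<^sub>m (length la)"
  proof (rule eq_matI)
    fix p p' assume "p < dim_row (1\<^sub>m (length la) :: 'k mat)" "p' < dim_col (1\<^sub>m (length la) :: 'k mat)"
    then have pp: "p < length la" "p' < length la" by auto
    let ?a = "la ! p" and ?a' = "la ! p'"
    have "(A' * B') $$ (p, p') = (\<Sum>q<length lb. A $$ (?a, lb ! q) * B $$ (lb ! q, ?a'))"
      unfolding mult_mat_entry[OF c pp] using pp by (simp add: A'_def B'_def)
    also have "\<dots> = (\<Sum>b\<in>set lb. A $$ (?a, b) * B $$ (b, ?a'))"
      by (rule sum.reindex_bij_betw[OF bij_betw_nth[OF lb(1) refl refl]])
    also have "\<dots> = (\<Sum>b<length es. A $$ (?a, b) * B $$ (b, ?a'))"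
      using deg[of ?a] la_nth[OF pp(1)] unfolding lb(2)
      by (intro sum.mono_neutral_left) auto
    also have "\<dots> = 1\<^sub>m (length ds) $$ (?a, ?a')"
      using mult_mat_entry[OF A B, of ?a ?a'] la_nth pp AB by simp
    also have "\<dots> = 1\<^sub>m (length la) $$ (p, p')"
      using la_nth pp la(1) by (simp add: nth_eq_iff_index_eq)
    finally show "(A' * B') $$ (p, p') = 1\<^sub>m (length la) $$ (p, p')" .
  qed (use c in auto)
  from left_invertible_rows_le_cols[OF c this] show ?thesis
    by (simp add: count_list_eq_length_filter_positions la_def lb_def)
qed

text \<open>The composite \<open>\<psi> \<phi>\<close> of the comparison maps lifts the identity, so it differs from the
  identity by a null-homotopic map. Modulo the variables, \<open>\<psi>\<close> is thus a left inverse of \<open>\<phi>\<close> in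
  every homological degree.\<close>

lemma count_shifts_le:
  assumes F: "minimal_graded_free_resolution V I F" and G: "graded_free_resolution V I G"
  shows "count_list (shifts F i) j \<le> count_list (shifts G i) j"
proof -
  have res: "graded_free_resolution V I F"
    using F by (simp add: minimal_graded_free_resolution_def)
  obtain \<phi> where \<phi>: "\<And>i. graded_map V (shifts F i) (shifts G i) (\<phi> i)"
      "boundary G 0 * \<phi> 0 = boundary F 0"
      "\<And>i. boundary G (Suc i) * \<phi> (Suc i) = \<phi> i * boundary F (Suc i)"
    using chain_map_exists[OF res G] by blast
  obtain \<psi> where \<psi>: "\<And>i. graded_map V (shifts G i) (shifts F i) (\<psi> i)"
      "boundary F 0 * \<psi> 0 = boundary G 0"
      "\<And>i. boundary F (Suc i) * \<psi> (Suc i) = \<psi> i * boundary G (Suc i)"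
    using chain_map_exists[OF G res] by blast
  note c\<phi> = graded_map_carrier[OF \<phi>(1)] and c\<psi> = graded_map_carrier[OF \<psi>(1)]
  note cF = resolution_boundary_carrier[OF res] and cG = resolution_boundary_carrier[OF G]
  define e where "e i = \<psi> i * \<phi> i - 1\<^sub>m (length (shifts F i))" for i
  have e: "graded_map V (shifts F i) (shifts F i) (e i)" for i
    unfolding e_def by (intro graded_map_diff graded_map_mult[OF \<psi>(1) \<phi>(1)] graded_map_one)
  have c: "\<psi> i * \<phi> i \<in> carrier_mat (length (shifts F i)) (length (shifts F i))" for i
    using mult_carrier_mat[OF c\<psi> c\<phi>] .
  have e0: "boundary F 0 * e 0 = 0\<^sub>m 1 (length (shifts F 0))"
  proof -
    have "boundary F 0 * e 0 = boundary F 0 * (\<psi> 0 * \<phi> 0) - boundary F 0"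
      unfolding e_def using mult_minus_distrib_mat[OF cF[of 0] c one_carrier_mat] cF[of 0] by simp
    also have "boundary F 0 * (\<psi> 0 * \<phi> 0) = boundary F 0"
      using assoc_mult_mat[OF cF[of 0] c\<psi> c\<phi>] \<phi>(2) \<psi>(2) by simp
    finally show ?thesis using cF[of 0] by simp
  qed
  have comm: "boundary F (Suc i) * e (Suc i) = e i * boundary F (Suc i)" for i
  proof -
    note cFi = cF[of "Suc i", simplified] and cGi = cG[of "Suc i", simplified]
    have "boundary F (Suc i) * (\<psi> (Suc i) * \<phi> (Suc i)) = \<psi> i * (boundary G (Suc i) * \<phi> (Suc i))"
      using assoc_mult_mat[OF cFi c\<psi> c\<phi>] assoc_mult_mat[OF c\<psi> cGi c\<phi>] \<psi>(3)[of i] by simp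
    also have "\<dots> = \<psi> i * \<phi> i * boundary F (Suc i)"
      unfolding \<phi>(3) using assoc_mult_mat[OF c\<psi> c\<phi> cFi] by simp
    finally show ?thesis
      unfolding e_def
      using mult_minus_distrib_mat[OF cFi c one_carrier_mat] minus_mult_distrib_mat[OF c one_carrier_mat cFi]
        cFi by simp
  qed
  let ?n = "length (shifts F i)"
  have inv: "constant_part (\<psi> i) * constant_part (\<phi> i) = 1\<^sub>m ?n"
  proof -
    have 0: "constant_part (e i) = 0\<^sub>m ?n ?n"
      using constant_part_null_homotopic[OF F e e0 comm] .
    have "constant_part (\<psi> i * \<phi> i) = 1\<^sub>m ?n"
      using 0 constant_part_diff[OF c[of i] one_carrier_mat] c[of i]
        diff_eq_0_mat_iff[of "constant_part (\<psi> i * \<phi> i)" ?n ?n "1\<^sub>m ?n"]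
      by (simp add: e_def constant_part_one)
    then show ?thesis using constant_part_mult[OF c\<psi> c\<phi>] by simp
  qed
  show ?thesis
  proof (rule count_le_if_graded_left_inverse[OF _ _ inv])
    fix a b assume ab: "a < length (shifts F i)" "b < length (shifts G i)"
      "constant_part (\<psi> i) $$ (a, b) \<noteq> 0"
    then have "0 \<in> Poly_Mapping.keys (\<psi> i $$ (a, b))"
      using c\<psi>[of i] by (simp add: constant_part_def in_keys_iff)
    from graded_mapD(2)[OF \<psi>(1) ab(1,2) this] show "shifts F i ! a = shifts G i ! b" by simp
  qed (use c\<phi> c\<psi> in auto)
qed

theorem graded_betti_eq_count:
  assumes F: "minimal_graded_free_resolution V I F"
  shows "graded_betti V I i j = count_list (shifts F i) j"
  unfolding graded_betti_def
proof (rule the_equality)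
  show "\<exists>G. minimal_graded_free_resolution V I G \<and>
      count_list (shifts F i) j = count_list (shifts G i) j"
    using F by blast
  fix b assume "\<exists>G. minimal_graded_free_resolution V I G \<and> b = count_list (shifts G i) j"
  then obtain G where G: "minimal_graded_free_resolution V I G" "b = count_list (shifts G i) j"
    by blast
  then show "b = count_list (shifts F i) j"
    using count_shifts_le[of V I F G] count_shifts_le[of V I G F] F
    by (simp add: minimal_graded_free_resolution_def le_antisym)
qed

section \<open>The simplicial chain complex of a full simplex\<close>

text \<open>The sign with which \<open>\<tau>\<close> occurs in the boundary of \<open>insert j \<tau>\<close>, the vertices being ordered
  increasingly.\<close>

definition position_sign :: "nat \<Rightarrow> nat set \<Rightarrow> 'k::field" where
  "position_sign j \<tau> = (- 1) ^ card {i \<in> \<tau>. i < j}"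

text \<open>The coefficient of the face \<open>\<tau>\<close> in the boundary of the chain \<open>c\<close>. The empty set counts as a
  face, so this is the augmented complex.\<close>

definition simplex_boundary :: "nat \<Rightarrow> (nat set \<Rightarrow> 'k::field) \<Rightarrow> nat set \<Rightarrow> 'k" where
  "simplex_boundary N c \<tau> = (\<Sum>j\<in>{..<N} - \<tau>. position_sign j \<tau> * c (insert j \<tau>))"

lemma position_sign_insert:
  assumes "finite \<tau>" "k \<notin> \<tau>"
  shows "(position_sign j (insert k \<tau>) :: 'k::field) =
    (if k < j then - position_sign j \<tau> else position_sign j \<tau>)"
proof -
  have "{i \<in> insert k \<tau>. i < j} = (if k < j then insert k {i \<in> \<tau>. i < j} else {i \<in> \<tau>. i < j})"
    by auto
  then show ?thesis using assms by (simp add: position_sign_def)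
qed

lemma position_sign_least:
  assumes "\<And>i. i \<in> \<tau> \<Longrightarrow> j \<le> i"
  shows "position_sign j \<tau> = 1"
proof -
  have "{i \<in> \<tau>. i < j} = {}" using assms by (auto simp: not_less)
  then show ?thesis unfolding position_sign_def by (simp only: card.empty power_0)
qed

text \<open>In characteristic 2 this does not follow from the sum being its own negative, so the terms
  are cancelled in pairs.\<close>

lemma sum_antisymmetric_eq_0:
  fixes f :: "'a::linorder \<Rightarrow> 'a \<Rightarrow> 'b::ab_group_add"
  assumes "finite B" and f: "\<And>j k. j \<in> B \<Longrightarrow> k \<in> B \<Longrightarrow> j \<noteq> k \<Longrightarrow> f j k = - f k j"
  shows "(\<Sum>j\<in>B. \<Sum>k\<in>B - {j}. f j k) = 0"
proof -
  define g where "g j k = (if j < k then f j k else 0)" for j k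
  have "(\<Sum>j\<in>B. \<Sum>k\<in>B - {j}. f j k) = (\<Sum>j\<in>B. \<Sum>k\<in>B. g j k - g k j)"
  proof (rule sum.cong[OF refl])
    fix j assume j: "j \<in> B"
    have "(\<Sum>k\<in>B. g j k - g k j) = (\<Sum>k\<in>B - {j}. g j k - g k j)"
      by (subst sum.remove[OF \<open>finite B\<close> j]) (simp add: g_def)
    also have "\<dots> = (\<Sum>k\<in>B - {j}. f j k)"
    proof (rule sum.cong[OF refl])
      fix k assume "k \<in> B - {j}"
      then show "g j k - g k j = f j k" using f[of j k] j by (cases j k rule: linorder_cases) (auto simp: g_def)
    qed
    finally show "(\<Sum>k\<in>B - {j}. f j k) = (\<Sum>k\<in>B. g j k - g k j)" ..
  qed
  also have "\<dots> = (\<Sum>j\<in>B. \<Sum>k\<in>B. g j k) - (\<Sum>j\<in>B. \<Sum>k\<in>B. g k j)"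
    by (simp add: sum_subtractf)
  also have "(\<Sum>j\<in>B. \<Sum>k\<in>B. g k j) = (\<Sum>j\<in>B. \<Sum>k\<in>B. g j k)"
    by (rule sum.swap)
  finally show ?thesis by simp
qed

text \<open>Each face with two vertices removed is reached in two orders, and exactly one of the two
  signs involved changes with the order.\<close>

lemma simplex_boundary_boundary:
  fixes c :: "nat set \<Rightarrow> 'k::field"
  assumes "\<tau> \<subseteq> {..<N}"
  shows "simplex_boundary N (simplex_boundary N c) \<tau> = 0"
proof -
  have fin: "finite \<tau>" using assms finite_subset by blast
  let ?B = "{..<N} - \<tau>"
  define f where "f j k = position_sign j \<tau> * (position_sign k (insert j \<tau>) * c (insert k (insert j \<tau>)))"
    for j k
  have "simplex_boundary N (simplex_boundary N c) \<tau> = (\<Sum>j\<in>?B. \<Sum>k\<in>?B - {j}. f j k)"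
    unfolding simplex_boundary_def f_def sum_distrib_left
    by (intro sum.cong refl) auto
  also have "\<dots> = 0"
  proof (rule sum_antisymmetric_eq_0)
    fix j k assume jk: "j \<in> ?B" "k \<in> ?B" "j \<noteq> k"
    then show "f j k = - f k j"
      using fin by (cases j k rule: linorder_cases)
        (auto simp: f_def position_sign_insert insert_commute)
  qed simp
  finally show ?thesis .
qed

text \<open>Coning with a vertex \<open>i\<close> of the full simplex on \<open>A\<close> is a contracting homotopy. Taking for
  \<open>i\<close> the least vertex makes all signs of \<open>i\<close> equal to 1.\<close>

lemma simplex_boundary_cone:
  fixes c :: "nat set \<Rightarrow> 'k::field"
  assumes \<tau>: "\<tau> \<subseteq> {..<N}" and i: "i < N" "\<And>a. a \<in> A \<Longrightarrow> i \<le> a"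
    and supp: "\<And>\<sigma>. c \<sigma> \<noteq> 0 \<Longrightarrow> \<sigma> \<subseteq> A"
    and cycle: "i \<in> \<tau> \<Longrightarrow> simplex_boundary N c (\<tau> - {i}) = 0"
  shows "simplex_boundary N (\<lambda>\<sigma>. if i \<in> \<sigma> then c (\<sigma> - {i}) else 0) \<tau> = c \<tau>"
proof (cases "i \<in> \<tau>")
  case False
  have "simplex_boundary N (\<lambda>\<sigma>. if i \<in> \<sigma> then c (\<sigma> - {i}) else 0) \<tau> =
      (\<Sum>j\<in>{..<N} - \<tau>. if j = i then position_sign i \<tau> * c \<tau> else 0)"
    unfolding simplex_boundary_def using False by (intro sum.cong refl) auto
  also have "\<dots> = position_sign i \<tau> * c \<tau>"
    using False i(1) by simp
  also have "\<dots> = c \<tau>"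
  proof (cases "c \<tau> = 0")
    case False
    then have "\<And>a. a \<in> \<tau> \<Longrightarrow> i \<le> a" using supp i(2) by blast
    then show ?thesis by (simp add: position_sign_least)
  qed simp
  finally show ?thesis .
next
  case True
  define \<rho> where "\<rho> = \<tau> - {i}"
  have \<rho>: "\<tau> = insert i \<rho>" "i \<notin> \<rho>" "finite \<rho>"
    using True \<tau> finite_subset[of \<tau> "{..<N}"] by (auto simp: \<rho>_def)
  have "simplex_boundary N (\<lambda>\<sigma>. if i \<in> \<sigma> then c (\<sigma> - {i}) else 0) \<tau> =
      (\<Sum>j\<in>{..<N} - \<rho> - {i}. position_sign j \<tau> * c (insert j \<rho>))"
    unfolding simplex_boundary_def using \<rho>(1,2) by (intro sum.cong) (auto simp: insert_Diff_if)
  also have "\<dots> = (\<Sum>j\<in>{..<N} - \<rho> - {i}. - (position_sign j \<rho> * c (insert j \<rho>)))"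
  proof (rule sum.cong[OF refl])
    fix j assume j: "j \<in> {..<N} - \<rho> - {i}"
    show "position_sign j \<tau> * c (insert j \<rho>) = - (position_sign j \<rho> * c (insert j \<rho>))"
    proof (cases "c (insert j \<rho>) = 0")
      case False
      then have "i < j" using supp i(2)[of j] j by fastforce
      then show ?thesis using \<rho> j by (simp add: position_sign_insert)
    qed simp
  qed
  also have "\<dots> = position_sign i \<rho> * c \<tau> - simplex_boundary N c \<rho>"
    unfolding simplex_boundary_def using \<rho> i(1) by (simp add: sum_negf sum.remove[of _ i])
  also have "\<dots> = position_sign i \<rho> * c \<tau>"
    using cycle True by (simp add: \<rho>_def)
  also have "\<dots> = c \<tau>"
  proof (cases "c \<tau> = 0")
    case False
    then have "\<And>a. a \<in> \<rho> \<Longrightarrow> i \<le> a" using supp i(2) \<rho>(1) by blast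
    then show ?thesis by (simp add: position_sign_least)
  qed simp
  finally show ?thesis .
qed

section \<open>The Taylor complex of a monomial ideal\<close>

definition monomial_dvd :: "('v \<Rightarrow>\<^sub>0 nat) \<Rightarrow> ('v \<Rightarrow>\<^sub>0 nat) \<Rightarrow> bool" where
  "monomial_dvd a b \<longleftrightarrow> (\<forall>v. Poly_Mapping.lookup a v \<le> Poly_Mapping.lookup b v)"

lemma monomial_dvd_add_diff: "monomial_dvd a b \<Longrightarrow> a + (b - a) = b"
  by (rule poly_mapping_eqI) (simp add: monomial_dvd_def lookup_add lookup_minus)

lemma monomial_add_diff_assoc: "monomial_dvd a b \<Longrightarrow> m + b - a = m + (b - a)"
  by (rule poly_mapping_eqI) (simp add: monomial_dvd_def lookup_add lookup_minus)

lemma monomial_dvd_add [simp]: "monomial_dvd a (a + b)" "monomial_dvd a (b + a)"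
  by (simp_all add: monomial_dvd_def lookup_add)

lemma monomial_dvd_trans: "monomial_dvd a b \<Longrightarrow> monomial_dvd b c \<Longrightarrow> monomial_dvd a c"
  unfolding monomial_dvd_def using le_trans by blast

lemma lookup_single_mult:
  fixes p :: "('v, 'k::field) mpoly"
  shows "Poly_Mapping.lookup (Poly_Mapping.single a s * p) m =
    (if monomial_dvd a m then s * Poly_Mapping.lookup p (m - a) else 0)"
proof -
  have eq: "a + b = m \<longleftrightarrow> monomial_dvd a m \<and> b = m - a" for b
    using monomial_dvd_add_diff[of a m] by auto
  have "Poly_Mapping.lookup (Poly_Mapping.single a s * p) m =
     (\<Sum>b\<in>Poly_Mapping.keys p. if b = m - a then (if monomial_dvd a m
        then s * Poly_Mapping.lookup p (m - a) else 0) else 0)"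
    unfolding lookup_mult_eq_sum by (cases "s = 0") (auto simp: eq when_def intro!: sum.cong)
  then show ?thesis by (simp add: in_keys_iff)
qed

text \<open>The 0 in the maximum makes the least common multiple of no monomials the monomial 1.\<close>

definition monomial_lcm :: "(nat \<Rightarrow> 'v \<Rightarrow>\<^sub>0 nat) \<Rightarrow> nat set \<Rightarrow> 'v \<Rightarrow>\<^sub>0 nat" where
  "monomial_lcm g \<sigma> = Abs_poly_mapping (\<lambda>v. Max (insert 0 ((\<lambda>i. Poly_Mapping.lookup (g i) v) ` \<sigma>)))"

lemma lookup_monomial_lcm:
  assumes "finite \<sigma>"
  shows "Poly_Mapping.lookup (monomial_lcm g \<sigma>) v =
    Max (insert 0 ((\<lambda>i. Poly_Mapping.lookup (g i) v) ` \<sigma>))"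
proof -
  have "{v. Max (insert 0 ((\<lambda>i. Poly_Mapping.lookup (g i) v) ` \<sigma>)) \<noteq> 0} \<subseteq>
      (\<Union>i\<in>\<sigma>. Poly_Mapping.keys (g i))"
  proof
    fix v assume v: "v \<in> {v. Max (insert 0 ((\<lambda>i. Poly_Mapping.lookup (g i) v) ` \<sigma>)) \<noteq> 0}"
    then have "Max (insert 0 ((\<lambda>i. Poly_Mapping.lookup (g i) v) ` \<sigma>)) \<in>
        insert 0 ((\<lambda>i. Poly_Mapping.lookup (g i) v) ` \<sigma>)"
      using assms by (intro Max_in) auto
    then show "v \<in> (\<Union>i\<in>\<sigma>. Poly_Mapping.keys (g i))"
      using v by (auto simp: in_keys_iff)
  qed
  then have "finite {v. Max (insert 0 ((\<lambda>i. Poly_Mapping.lookup (g i) v) ` \<sigma>)) \<noteq> 0}"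
    by (rule finite_subset) (use assms in simp)
  then show ?thesis by (simp add: monomial_lcm_def)
qed

lemma monomial_lcm_dvd_iff:
  "finite \<sigma> \<Longrightarrow> monomial_dvd (monomial_lcm g \<sigma>) \<mu> \<longleftrightarrow> (\<forall>i\<in>\<sigma>. monomial_dvd (g i) \<mu>)"
  by (auto simp: monomial_dvd_def lookup_monomial_lcm)

lemma dvd_monomial_lcm:
  assumes "finite \<sigma>" "i \<in> \<sigma>"
  shows "monomial_dvd (g i) (monomial_lcm g \<sigma>)"
  using monomial_lcm_dvd_iff[OF assms(1), of g "monomial_lcm g \<sigma>"] assms(2)
  by (simp add: monomial_dvd_def)

lemma monomial_lcm_mono:
  "finite \<sigma> \<Longrightarrow> \<tau> \<subseteq> \<sigma> \<Longrightarrow> monomial_dvd (monomial_lcm g \<tau>) (monomial_lcm g \<sigma>)"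
  using finite_subset[of \<tau> \<sigma>] by (auto simp: monomial_lcm_dvd_iff intro: dvd_monomial_lcm)

lemma monomial_lcm_empty [simp]: "monomial_lcm g {} = 0"
  by (simp add: monomial_lcm_def)

lemma monomial_lcm_singleton [simp]: "monomial_lcm g {i} = g i"
  by (rule poly_mapping_eqI) (simp add: lookup_monomial_lcm)

lemma keys_monomial_lcm:
  assumes "finite \<sigma>" "\<And>i. i \<in> \<sigma> \<Longrightarrow> Poly_Mapping.keys (g i) \<subseteq> V"
  shows "Poly_Mapping.keys (monomial_lcm g \<sigma>) \<subseteq> V"
proof
  fix v assume v: "v \<in> Poly_Mapping.keys (monomial_lcm g \<sigma>)"
  show "v \<in> V"
  proof (rule ccontr)
    assume "v \<notin> V"
    then have "Poly_Mapping.lookup (g i) v = 0" if "i \<in> \<sigma>" for i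
      using assms(2)[OF that] by (auto simp: in_keys_iff)
    then have "insert 0 ((\<lambda>i. Poly_Mapping.lookup (g i) v) ` \<sigma>) = {0}" by auto
    then have "Poly_Mapping.lookup (monomial_lcm g \<sigma>) v = 0"
      unfolding lookup_monomial_lcm[OF assms(1)] by (simp only: Max_singleton)
    then show False using v by (simp add: in_keys_iff)
  qed
qed

text \<open>The differential of the Taylor complex, with chains as functions on sets of generators. The
  empty set stands for the basis element 1 of the ring, so the augmentation to the ring is
  included.\<close>

definition taylor_boundary ::
    "(nat \<Rightarrow> 'v \<Rightarrow>\<^sub>0 nat) \<Rightarrow> nat \<Rightarrow> (nat set \<Rightarrow> ('v, 'k::field) mpoly) \<Rightarrow> nat set \<Rightarrow> ('v, 'k) mpoly" where
  "taylor_boundary g N c \<tau> = (\<Sum>j\<in>{..<N} - \<tau>.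
     Poly_Mapping.single (monomial_lcm g (insert j \<tau>) - monomial_lcm g \<tau>) (position_sign j \<tau>) *
       c (insert j \<tau>))"

text \<open>The basis element of a set \<open>\<sigma>\<close> has multidegree \<open>monomial_lcm g \<sigma>\<close>; this is the coefficient
  function of the component of a chain in multidegree \<open>\<mu>\<close>. On these components the Taylor boundary
  is the boundary of the simplex on the generators that divide \<open>\<mu>\<close>.\<close>

definition multigraded_part ::
    "(nat \<Rightarrow> 'v \<Rightarrow>\<^sub>0 nat) \<Rightarrow> (nat set \<Rightarrow> ('v, 'k::field) mpoly) \<Rightarrow> ('v \<Rightarrow>\<^sub>0 nat) \<Rightarrow> nat set \<Rightarrow> 'k" where
  "multigraded_part g c \<mu> \<sigma> = (if monomial_dvd (monomial_lcm g \<sigma>) \<mu>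
     then Poly_Mapping.lookup (c \<sigma>) (\<mu> - monomial_lcm g \<sigma>) else 0)"

lemma multigraded_part_eqD:
  assumes "\<And>\<mu>. multigraded_part g c \<mu> \<sigma> = multigraded_part g d \<mu> \<sigma>"
  shows "c \<sigma> = d \<sigma>"
proof (rule poly_mapping_eqI)
  fix m
  show "Poly_Mapping.lookup (c \<sigma>) m = Poly_Mapping.lookup (d \<sigma>) m"
    using assms[of "m + monomial_lcm g \<sigma>"] by (simp add: multigraded_part_def)
qed

lemma multigraded_part_taylor_boundary:
  assumes "\<tau> \<subseteq> {..<N}"
  shows "multigraded_part g (taylor_boundary g N c) \<mu> \<tau> =
    simplex_boundary N (multigraded_part g c \<mu>) \<tau>"
proof -
  have fin: "finite \<tau>" using assms finite_subset by blast
  let ?L = "monomial_lcm g"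
  show ?thesis
  proof (cases "monomial_dvd (?L \<tau>) \<mu>")
    case True
    have "Poly_Mapping.lookup (Poly_Mapping.single (?L (insert j \<tau>) - ?L \<tau>) (position_sign j \<tau>) *
        c (insert j \<tau>)) (\<mu> - ?L \<tau>) = position_sign j \<tau> * multigraded_part g c \<mu> (insert j \<tau>)" for j
    proof -
      have d: "?L \<tau> + (?L (insert j \<tau>) - ?L \<tau>) = ?L (insert j \<tau>)" "?L \<tau> + (\<mu> - ?L \<tau>) = \<mu>"
        using monomial_lcm_mono[of "insert j \<tau>" \<tau> g] fin True by (auto intro: monomial_dvd_add_diff)
      then have "monomial_dvd (?L (insert j \<tau>) - ?L \<tau>) (\<mu> - ?L \<tau>) \<longleftrightarrow> monomial_dvd (?L (insert j \<tau>)) \<mu>"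
        unfolding monomial_dvd_def by (metis add_le_cancel_left lookup_add)
      moreover have "\<mu> - ?L \<tau> - (?L (insert j \<tau>) - ?L \<tau>) = \<mu> - ?L (insert j \<tau>)"
        using d by (metis diff_diff_add)
      ultimately show ?thesis by (simp add: lookup_single_mult multigraded_part_def)
    qed
    then show ?thesis
      using True by (simp add: multigraded_part_def[of g "taylor_boundary g N c"] taylor_boundary_def
          simplex_boundary_def lookup_sum)
  next
    case False
    have "multigraded_part g c \<mu> (insert j \<tau>) = 0" for j
      using False monomial_lcm_mono[of "insert j \<tau>" \<tau> g] fin
      by (auto simp: multigraded_part_def dest: monomial_dvd_trans)
    then show ?thesis using False by (simp add: multigraded_part_def[of g "taylor_boundary g N c"] simplex_boundary_def)
  qed
qed

lemma taylor_boundary_boundary: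
  assumes "\<tau> \<subseteq> {..<N}"
  shows "taylor_boundary g N (taylor_boundary g N c) \<tau> = 0"
proof -
  have "multigraded_part g (taylor_boundary g N (taylor_boundary g N c)) \<mu> \<tau> =
      multigraded_part g (\<lambda>_. 0) \<mu> \<tau>" for \<mu>
  proof -
    have "multigraded_part g (taylor_boundary g N (taylor_boundary g N c)) \<mu> \<tau> =
        simplex_boundary N (multigraded_part g (taylor_boundary g N c) \<mu>) \<tau>"
      by (rule multigraded_part_taylor_boundary[OF assms])
    also have "\<dots> = simplex_boundary N (simplex_boundary N (multigraded_part g c \<mu>)) \<tau>"
      unfolding simplex_boundary_def[of _ "multigraded_part g (taylor_boundary g N c) \<mu>"]
        simplex_boundary_def[of _ "simplex_boundary N (multigraded_part g c \<mu>)"]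
      using assms by (intro sum.cong refl arg_cong2[where f="(*)"] multigraded_part_taylor_boundary) auto
    also have "\<dots> = 0" by (rule simplex_boundary_boundary[OF assms])
    finally show ?thesis by (simp add: multigraded_part_def)
  qed
  then show ?thesis by (rule multigraded_part_eqD)
qed

definition least_divisor :: "(nat \<Rightarrow> 'v \<Rightarrow>\<^sub>0 nat) \<Rightarrow> nat \<Rightarrow> ('v \<Rightarrow>\<^sub>0 nat) \<Rightarrow> nat" where
  "least_divisor g N \<mu> = Min {i. i < N \<and> monomial_dvd (g i) \<mu>}"

text \<open>The cone with the least generator dividing the multidegree, one multidegree at a time: the
  monomial \<open>m\<close> in the coefficient of \<open>\<sigma>\<close> lies in multidegree \<open>m + monomial_lcm g \<sigma>\<close>.\<close>

definition taylor_cone ::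
    "(nat \<Rightarrow> 'v \<Rightarrow>\<^sub>0 nat) \<Rightarrow> nat \<Rightarrow> (nat set \<Rightarrow> ('v, 'k::field) mpoly) \<Rightarrow> nat set \<Rightarrow> ('v, 'k) mpoly" where
  "taylor_cone g N c \<sigma> = Abs_poly_mapping (\<lambda>m.
     let \<mu> = m + monomial_lcm g \<sigma>; i = least_divisor g N \<mu>
     in if i \<in> \<sigma> then multigraded_part g c \<mu> (\<sigma> - {i}) else 0)"

text \<open>This needs that the coefficients in the definition are almost all 0. For a fixed cone
  vertex \<open>i\<close> they come from the polynomial \<open>c (\<sigma> - {i})\<close> by shifting exponents.\<close>

lemma lookup_taylor_cone:
  assumes fin: "finite \<sigma>"
  shows "Poly_Mapping.lookup (taylor_cone g N c \<sigma>) m =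
    (let \<mu> = m + monomial_lcm g \<sigma>; i = least_divisor g N \<mu>
     in if i \<in> \<sigma> then multigraded_part g c \<mu> (\<sigma> - {i}) else 0)" (is "_ = ?f m")
proof -
  let ?L = "monomial_lcm g"
  have "{m. ?f m \<noteq> 0} \<subseteq> (\<Union>i\<in>\<sigma>. (\<lambda>m. m + (?L \<sigma> - ?L (\<sigma> - {i}))) -` Poly_Mapping.keys (c (\<sigma> - {i})))"
  proof
    fix m assume "m \<in> {m. ?f m \<noteq> 0}"
    then have nz: "?f m \<noteq> 0" by blast
    define i where "i = least_divisor g N (m + ?L \<sigma>)"
    have i: "i \<in> \<sigma>" "multigraded_part g c (m + ?L \<sigma>) (\<sigma> - {i}) \<noteq> 0"
      using nz unfolding Let_def i_def[symmetric] by (simp_all split: if_splits)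
    have "m + ?L \<sigma> - ?L (\<sigma> - {i}) = m + (?L \<sigma> - ?L (\<sigma> - {i}))"
      using fin by (intro monomial_add_diff_assoc monomial_lcm_mono) auto
    then have "m + (?L \<sigma> - ?L (\<sigma> - {i})) \<in> Poly_Mapping.keys (c (\<sigma> - {i}))"
      using i(2) by (simp add: multigraded_part_def in_keys_iff split: if_splits)
    then show "m \<in> (\<Union>i\<in>\<sigma>. (\<lambda>m. m + (?L \<sigma> - ?L (\<sigma> - {i}))) -` Poly_Mapping.keys (c (\<sigma> - {i})))"
      using i(1) by blast
  qed
  moreover have "finite \<dots>"
    using fin by (auto intro!: finite_vimageI simp: inj_def)
  ultimately have "finite {m. ?f m \<noteq> 0}" by (rule finite_subset)
  then show ?thesis by (simp add: taylor_cone_def)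
qed

lemma taylor_cone_in_poly_ring:
  assumes fin: "finite \<sigma>" and c: "\<And>\<sigma>. c \<sigma> \<in> poly_ring V"
  shows "taylor_cone g N c \<sigma> \<in> poly_ring V"
  unfolding poly_ring_def
proof (intro CollectI ballI)
  let ?L = "monomial_lcm g"
  fix m assume "m \<in> Poly_Mapping.keys (taylor_cone g N c \<sigma>)"
  then have nz: "Poly_Mapping.lookup (taylor_cone g N c \<sigma>) m \<noteq> 0" by (simp add: in_keys_iff)
  define i where "i = least_divisor g N (m + ?L \<sigma>)"
  have i: "i \<in> \<sigma>" "multigraded_part g c (m + ?L \<sigma>) (\<sigma> - {i}) \<noteq> 0"
    using nz unfolding lookup_taylor_cone[OF fin] Let_def i_def[symmetric]
    by (simp_all split: if_splits)
  have "m + ?L \<sigma> - ?L (\<sigma> - {i}) = m + (?L \<sigma> - ?L (\<sigma> - {i}))"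
    using fin by (intro monomial_add_diff_assoc monomial_lcm_mono) auto
  then have "m + (?L \<sigma> - ?L (\<sigma> - {i})) \<in> Poly_Mapping.keys (c (\<sigma> - {i}))"
    using i(2) by (simp add: multigraded_part_def in_keys_iff split: if_splits)
  then have "Poly_Mapping.keys (m + (?L \<sigma> - ?L (\<sigma> - {i}))) \<subseteq> V"
    using c[of "\<sigma> - {i}"] by (auto simp: poly_ring_def)
  then show "Poly_Mapping.keys m \<subseteq> V"
    unfolding keys_add_monomial by blast
qed

text \<open>In every multidegree this is \<open>simplex_boundary_cone\<close> for the generators that divide it; if
  there are none, both sides vanish on non-empty sets.\<close>

lemma taylor_boundary_cone:
  assumes \<tau>: "\<tau> \<subseteq> {..<N}" "\<tau> \<noteq> {}"
    and cycle: "\<And>i. i \<in> \<tau> \<Longrightarrow> taylor_boundary g N c (\<tau> - {i}) = 0"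
    and supp: "c {} = 0"
  shows "taylor_boundary g N (taylor_cone g N c) \<tau> = c \<tau>"
proof (rule multigraded_part_eqD[where g = g])
  fix \<mu>
  let ?L = "monomial_lcm g"
  define A where "A = {i. i < N \<and> monomial_dvd (g i) \<mu>}"
  define i where "i = least_divisor g N \<mu>"
  \<comment> \<open>Sets with elements outside \<open>{..<N}\<close> name no generators and have to be cut off, so that the
    support of the chain lies in \<open>A\<close>.\<close>
  define c' where "c' \<sigma> = (if \<sigma> \<subseteq> {..<N} then multigraded_part g c \<mu> \<sigma> else 0)" for \<sigma>
  have fin: "finite \<sigma>" if "\<sigma> \<subseteq> {..<N}" for \<sigma> :: "nat set" using that finite_subset by blast
  have dvd_iff: "monomial_dvd (?L \<sigma>) \<mu> \<longleftrightarrow> \<sigma> \<subseteq> A" if "\<sigma> \<subseteq> {..<N}" for \<sigma>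
    using that by (auto simp: A_def monomial_lcm_dvd_iff[OF fin[OF that]])
  have supp_A: "c' \<sigma> \<noteq> 0 \<Longrightarrow> \<sigma> \<subseteq> A" for \<sigma>
    using dvd_iff[of \<sigma>] by (auto simp: c'_def multigraded_part_def split: if_splits)
  have c'_boundary: "simplex_boundary N c' \<rho> = multigraded_part g (taylor_boundary g N c) \<mu> \<rho>"
    if "\<rho> \<subseteq> {..<N}" for \<rho>
    using that unfolding multigraded_part_taylor_boundary[OF that] simplex_boundary_def
    by (intro sum.cong refl) (auto simp: c'_def)
  have "multigraded_part g (taylor_boundary g N (taylor_cone g N c)) \<mu> \<tau> =
      simplex_boundary N (multigraded_part g (taylor_cone g N c) \<mu>) \<tau>"
    by (rule multigraded_part_taylor_boundary[OF \<tau>(1)])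
  also have "\<dots> = multigraded_part g c \<mu> \<tau>"
  proof (cases "A = {}")
    case True
    then have 0: "multigraded_part g d \<mu> \<sigma> = 0" if "\<sigma> \<subseteq> {..<N}" "\<sigma> \<noteq> {}" for \<sigma> and d :: "nat set \<Rightarrow> ('a, 'b) mpoly"
      using dvd_iff[OF that(1)] that(2) by (simp add: multigraded_part_def)
    show ?thesis
      unfolding simplex_boundary_def 0[OF \<tau>] using \<tau>(1) by (intro sum.neutral ballI) (auto simp: 0)
  next
    case False
    have i: "i \<in> A" "\<And>a. a \<in> A \<Longrightarrow> i \<le> a"
      using Min_in[of A] False by (auto simp: i_def A_def least_divisor_def)
    have "multigraded_part g (taylor_cone g N c) \<mu> \<sigma> = (if i \<in> \<sigma> then c' (\<sigma> - {i}) else 0)"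
      if \<sigma>: "\<sigma> \<subseteq> {..<N}" for \<sigma>
    proof (cases "monomial_dvd (?L \<sigma>) \<mu>")
      case True
      have "\<mu> - ?L \<sigma> + ?L \<sigma> = \<mu>" using monomial_dvd_add_diff[OF True] by (simp add: add.commute)
      then have "multigraded_part g (taylor_cone g N c) \<mu> \<sigma> =
          (if i \<in> \<sigma> then multigraded_part g c \<mu> (\<sigma> - {i}) else 0)"
        using True by (simp add: multigraded_part_def[of g "taylor_cone g N c"]
            lookup_taylor_cone[OF fin[OF \<sigma>]] Let_def i_def)
      moreover have "\<sigma> - {i} \<subseteq> {..<N}" using \<sigma> by auto
      ultimately show ?thesis by (simp add: c'_def)
    next
      case False
      then have "i \<in> \<sigma> \<Longrightarrow> c' (\<sigma> - {i}) = 0"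
        using dvd_iff[OF \<sigma>] supp_A[of "\<sigma> - {i}"] i(1) by blast
      then show ?thesis using False by (simp add: multigraded_part_def)
    qed
    then have "simplex_boundary N (multigraded_part g (taylor_cone g N c) \<mu>) \<tau> =
        simplex_boundary N (\<lambda>\<sigma>. if i \<in> \<sigma> then c' (\<sigma> - {i}) else 0) \<tau>"
      unfolding simplex_boundary_def using \<tau>(1) by (intro sum.cong refl) auto
    also have "\<dots> = c' \<tau>"
    proof (rule simplex_boundary_cone[OF \<tau>(1) _ i(2) supp_A])
      show "i < N" using i(1) by (simp add: A_def)
      assume "i \<in> \<tau>"
      moreover have "\<tau> - {i} \<subseteq> {..<N}" using \<tau>(1) by auto
      ultimately show "simplex_boundary N c' (\<tau> - {i}) = 0"
        using c'_boundary[of "\<tau> - {i}"] cycle[of i] by (simp add: multigraded_part_def)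
    qed
    finally show ?thesis using \<tau>(1) by (simp add: c'_def)
  qed
  finally show "multigraded_part g (taylor_boundary g N (taylor_cone g N c)) \<mu> \<tau> =
    multigraded_part g c \<mu> \<tau>" .
qed

section \<open>The Taylor resolution\<close>

text \<open>An ordered basis of the Taylor complex in homological degree \<open>i - 1\<close>; for \<open>i = 0\<close>, of the
  ring.\<close>

definition subset_list :: "nat \<Rightarrow> nat \<Rightarrow> nat set list" where
  "subset_list N i = (SOME xs. set xs = {\<sigma>. \<sigma> \<subseteq> {..<N} \<and> card \<sigma> = i} \<and> distinct xs)"

lemma set_subset_list: "set (subset_list N i) = {\<sigma>. \<sigma> \<subseteq> {..<N} \<and> card \<sigma> = i}"
  and distinct_subset_list: "distinct (subset_list N i)"
proof -
  have "finite {\<sigma>. \<sigma> \<subseteq> {..<N} \<and> card \<sigma> = i}" by simp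
  then have "\<exists>xs. set xs = {\<sigma>. \<sigma> \<subseteq> {..<N} \<and> card \<sigma> = i} \<and> distinct xs"
    by (rule finite_distinct_list)
  from someI_ex[OF this]
  show "set (subset_list N i) = {\<sigma>. \<sigma> \<subseteq> {..<N} \<and> card \<sigma> = i}" "distinct (subset_list N i)"
    unfolding subset_list_def by auto
qed

lemma subset_list_0: "subset_list N 0 = [{}]"
proof -
  have "set (subset_list N 0) = {{}}"
    using finite_subset[of _ "{..<N}"] by (auto simp: set_subset_list card_eq_0_iff)
  then have "length (subset_list N 0) = 1"
    using distinct_card[OF distinct_subset_list[of N 0]] by simp
  with \<open>set (subset_list N 0) = {{}}\<close> show ?thesis
    by (cases "subset_list N 0") auto
qed

lemma nth_subset_list:
  "a < length (subset_list N i) \<Longrightarrow> subset_list N i ! a \<subseteq> {..<N} \<and> card (subset_list N i ! a) = i"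
  using nth_mem[of a "subset_list N i"] by (simp add: set_subset_list)

definition taylor_coefficient ::
    "(nat \<Rightarrow> 'v \<Rightarrow>\<^sub>0 nat) \<Rightarrow> nat set \<Rightarrow> nat set \<Rightarrow> ('v, 'k::field) mpoly" where
  "taylor_coefficient g \<tau> \<sigma> = (if \<exists>j. j \<notin> \<tau> \<and> \<sigma> = insert j \<tau>
     then Poly_Mapping.single (monomial_lcm g \<sigma> - monomial_lcm g \<tau>)
       (position_sign (the_elem (\<sigma> - \<tau>)) \<tau>)
     else 0)"

lemma taylor_coefficient_insert:
  assumes "j \<notin> \<tau>"
  shows "taylor_coefficient g \<tau> (insert j \<tau>) =
    Poly_Mapping.single (monomial_lcm g (insert j \<tau>) - monomial_lcm g \<tau>) (position_sign j \<tau>)"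
proof -
  have "insert j \<tau> - \<tau> = {j}" using assms by auto
  then show ?thesis using assms by (auto simp: taylor_coefficient_def)
qed

definition taylor_complex :: "(nat \<Rightarrow> 'v \<Rightarrow>\<^sub>0 nat) \<Rightarrow> nat \<Rightarrow> ('v, 'k::field) graded_complex" where
  "taylor_complex g N = \<lparr>
     shifts = (\<lambda>i. map (\<lambda>\<sigma>. monomial_degree (monomial_lcm g \<sigma>)) (subset_list N (Suc i))),
     boundary = (\<lambda>i. mat (length (subset_list N i)) (length (subset_list N (Suc i)))
       (\<lambda>(a, b). taylor_coefficient g (subset_list N i ! a) (subset_list N (Suc i) ! b)))\<rparr>"

definition chain_vec :: "nat \<Rightarrow> nat \<Rightarrow> (nat set \<Rightarrow> 'a) \<Rightarrow> 'a vec" where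
  "chain_vec N i c = vec (length (subset_list N i)) (\<lambda>a. c (subset_list N i ! a))"

lemma chain_vec_eq_iff:
  "chain_vec N i c = chain_vec N i d \<longleftrightarrow> (\<forall>\<sigma>. \<sigma> \<subseteq> {..<N} \<and> card \<sigma> = i \<longrightarrow> c \<sigma> = d \<sigma>)"
proof -
  have "chain_vec N i c = chain_vec N i d \<longleftrightarrow> (\<forall>\<sigma>\<in>set (subset_list N i). c \<sigma> = d \<sigma>)"
    by (auto simp: chain_vec_def vec_eq_iff all_set_conv_all_nth)
  then show ?thesis by (auto simp: set_subset_list)
qed

text \<open>Chains may be prolonged by 0 to all sets, because the boundary maps between the pieces of
  the complex only see the sets of the right cardinality.\<close>

lemma free_module_eq_chains:
  "free_module V (length (subset_list N i)) =
     chain_vec N i ` {c :: nat set \<Rightarrow> ('v, 'k::field) mpoly. (\<forall>\<sigma>. c \<sigma> \<in> poly_ring V) \<and> (\<forall>\<sigma>. card \<sigma> \<noteq> i \<longrightarrow> c \<sigma> = 0)}"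
proof (intro equalityI subsetI)
  fix f :: "('v, 'k) mpoly vec" assume f: "f \<in> free_module V (length (subset_list N i))"
  define c where "c \<sigma> = (\<Sum>a<length (subset_list N i). if subset_list N i ! a = \<sigma> then f $ a else 0)" for \<sigma>
  have "c (subset_list N i ! a) = f $ a" if "a < length (subset_list N i)" for a
  proof -
    have "c (subset_list N i ! a) = (\<Sum>b<length (subset_list N i). if b = a then f $ a else 0)"
      unfolding c_def using that distinct_subset_list[of N i]
      by (intro sum.cong refl) (auto simp: nth_eq_iff_index_eq)
    then show ?thesis using that by simp
  qed
  then have "f = chain_vec N i c"
    using f by (intro eq_vecI) (auto simp: chain_vec_def free_module_def)
  moreover have "c \<sigma> \<in> poly_ring V" for \<sigma>
    unfolding c_def using f by (intro poly_ring_sum) (auto simp: free_module_def)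
  moreover have "c \<sigma> = 0" if "card \<sigma> \<noteq> i" for \<sigma>
    unfolding c_def using nth_subset_list[of _ N i] that by (intro sum.neutral ballI) auto
  ultimately show "f \<in> chain_vec N i ` {c. (\<forall>\<sigma>. c \<sigma> \<in> poly_ring V) \<and> (\<forall>\<sigma>. card \<sigma> \<noteq> i \<longrightarrow> c \<sigma> = 0)}" by blast
qed (auto simp: chain_vec_def free_module_def)

lemma taylor_boundary_mat_mult:
  "boundary (taylor_complex g N) i *\<^sub>v chain_vec N (Suc i) c = chain_vec N i (taylor_boundary g N c)"
proof (rule eq_vecI)
  fix a assume "a < dim_vec (chain_vec N i (taylor_boundary g N c))"
  then have a: "a < length (subset_list N i)" by (simp add: chain_vec_def)
  define \<tau> where "\<tau> = subset_list N i ! a"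
  have \<tau>: "\<tau> \<subseteq> {..<N}" "card \<tau> = i" "finite \<tau>"
    using nth_subset_list[OF a] finite_subset by (auto simp: \<tau>_def)
  have "(boundary (taylor_complex g N) i *\<^sub>v chain_vec N (Suc i) c) $ a =
      (\<Sum>b<length (subset_list N (Suc i)).
        taylor_coefficient g \<tau> (subset_list N (Suc i) ! b) * c (subset_list N (Suc i) ! b))"
    using a by (simp add: taylor_complex_def chain_vec_def scalar_prod_def \<tau>_def atLeast0LessThan)
  also have "\<dots> = (\<Sum>\<sigma>\<in>set (subset_list N (Suc i)). taylor_coefficient g \<tau> \<sigma> * c \<sigma>)"
    by (rule sum.reindex_bij_betw[OF bij_betw_nth[OF distinct_subset_list refl refl]])
  also have "\<dots> = (\<Sum>\<sigma>\<in>(\<lambda>j. insert j \<tau>) ` ({..<N} - \<tau>). taylor_coefficient g \<tau> \<sigma> * c \<sigma>)"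
    using \<tau> by (intro sum.mono_neutral_right) (auto simp: set_subset_list taylor_coefficient_def)
  also have "\<dots> = (\<Sum>j\<in>{..<N} - \<tau>. taylor_coefficient g \<tau> (insert j \<tau>) * c (insert j \<tau>))"
    by (rule sum.reindex[unfolded o_def]) (auto simp: inj_on_def)
  also have "\<dots> = taylor_boundary g N c \<tau>"
    unfolding taylor_boundary_def by (intro sum.cong refl) (simp add: taylor_coefficient_insert)
  finally show "(boundary (taylor_complex g N) i *\<^sub>v chain_vec N (Suc i) c) $ a =
      chain_vec N i (taylor_boundary g N c) $ a"
    using a by (simp add: chain_vec_def \<tau>_def)
qed (simp add: taylor_complex_def chain_vec_def)

lemma taylor_boundary_in_poly_ring:
  assumes g: "\<And>i. i < N \<Longrightarrow> Poly_Mapping.keys (g i) \<subseteq> V" and c: "\<And>\<sigma>. c \<sigma> \<in> poly_ring V"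
    and \<tau>: "\<tau> \<subseteq> {..<N}"
  shows "taylor_boundary g N c \<tau> \<in> poly_ring V"
  unfolding taylor_boundary_def
proof (intro poly_ring_sum poly_ring_mult c)
  fix j assume j: "j \<in> {..<N} - \<tau>"
  have "Poly_Mapping.keys (monomial_lcm g (insert j \<tau>)) \<subseteq> V"
    using g \<tau> j finite_subset[OF \<tau>] by (intro keys_monomial_lcm) auto
  then show "Poly_Mapping.single (monomial_lcm g (insert j \<tau>) - monomial_lcm g \<tau>) (position_sign j \<tau>)
      \<in> poly_ring V"
    by (auto simp: poly_ring_def in_keys_iff lookup_minus split: if_splits)
qed

lemma taylor_graded_map:
  assumes g: "\<And>i. i < N \<Longrightarrow> Poly_Mapping.keys (g i) \<subseteq> V"
  shows "graded_map V (shifts (taylor_complex g N :: ('v, 'k::field) graded_complex) i)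
    (map (\<lambda>\<sigma>. monomial_degree (monomial_lcm g \<sigma>)) (subset_list N i))
    (boundary (taylor_complex g N :: ('v, 'k) graded_complex) i)"
  unfolding graded_map_def
proof (intro conjI allI impI ballI)
  let ?L = "monomial_lcm g"
  let ?F = "taylor_complex g N :: ('v, 'k) graded_complex"
  fix a b assume "a < length (map (\<lambda>\<sigma>. monomial_degree (?L \<sigma>)) (subset_list N i))"
    "b < length (shifts ?F i)"
  then have ab: "a < length (subset_list N i)" "b < length (subset_list N (Suc i))"
    by (simp_all add: taylor_complex_def)
  define \<tau> \<sigma> where "\<tau> = subset_list N i ! a" and "\<sigma> = subset_list N (Suc i) ! b"
  have \<sigma>: "\<sigma> \<subseteq> {..<N}" "finite \<sigma>"
    using nth_subset_list[OF ab(2)] finite_subset[of \<sigma> "{..<N}"] by (auto simp: \<sigma>_def)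
  have entry: "boundary ?F i $$ (a, b) = taylor_coefficient g \<tau> \<sigma>"
    using ab by (simp add: taylor_complex_def \<tau>_def \<sigma>_def)
  have keys: "\<tau> \<subseteq> \<sigma> \<and> m = ?L \<sigma> - ?L \<tau>"
    if "m \<in> Poly_Mapping.keys (boundary ?F i $$ (a, b))" for m
    using that unfolding entry taylor_coefficient_def by (auto split: if_splits)
  have "Poly_Mapping.keys (?L \<sigma>) \<subseteq> V"
    using g \<sigma> by (intro keys_monomial_lcm) auto
  then show "boundary ?F i $$ (a, b) \<in> poly_ring V"
    using keys unfolding poly_ring_def by (fastforce simp: in_keys_iff lookup_minus)
  fix m assume "m \<in> Poly_Mapping.keys (boundary ?F i $$ (a, b))"
  then have "m + ?L \<tau> = ?L \<sigma>"
    using keys[of m] monomial_dvd_add_diff[OF monomial_lcm_mono[OF \<sigma>(2), of \<tau> g]]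
    by (simp add: add.commute)
  then have "monomial_degree m + monomial_degree (?L \<tau>) = monomial_degree (?L \<sigma>)"
    by (simp flip: monomial_degree_add)
  then show "monomial_degree m + map (\<lambda>\<sigma>. monomial_degree (?L \<sigma>)) (subset_list N i) ! a = shifts ?F i ! b"
    using ab by (simp add: taylor_complex_def \<tau>_def \<sigma>_def)
qed (simp add: taylor_complex_def)

lemma taylor_map_image:
  "map_image V (boundary (taylor_complex g N) i) =
     (\<lambda>c. chain_vec N i (taylor_boundary g N c)) `
       {c :: nat set \<Rightarrow> ('v, 'k::field) mpoly. (\<forall>\<sigma>. c \<sigma> \<in> poly_ring V) \<and> (\<forall>\<sigma>. card \<sigma> \<noteq> Suc i \<longrightarrow> c \<sigma> = 0)}"
proof -
  have d: "dim_col (boundary (taylor_complex g N :: ('v, 'k) graded_complex) i) = length (subset_list N (Suc i))"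
    by (simp add: taylor_complex_def)
  show ?thesis
    unfolding map_image_def d free_module_eq_chains image_image taylor_boundary_mat_mult ..
qed

text \<open>Exactness comes from \<open>taylor_boundary_cone\<close>, since the matrices act on chains by
  \<open>taylor_boundary\<close>. The image of the augmentation is the ideal because the least common multiple
  of a single generator is that generator.\<close>

theorem taylor_resolution:
  assumes g: "\<And>i. i < N \<Longrightarrow> Poly_Mapping.keys (g i) \<subseteq> V" and inj: "inj_on g {..<N}"
  shows "graded_free_resolution V (generated_ideal V ((\<lambda>i. Poly_Mapping.single (g i) 1) ` {..<N}))
    (taylor_complex g N :: ('v, 'k::field) graded_complex)"
  unfolding graded_free_resolution_def
proof (intro conjI allI)
  let ?F = "taylor_complex g N :: ('v, 'k) graded_complex"
  let ?I = "generated_ideal V ((\<lambda>i. Poly_Mapping.single (g i) 1) ` {..<N}) :: ('v, 'k) mpoly set"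
  show "graded_map V (shifts ?F 0) [0] (boundary ?F 0)"
    using taylor_graded_map[where g = g and N = N and V = V and i = 0, OF g] by (simp add: subset_list_0)
  show "graded_map V (shifts ?F (Suc i)) (shifts ?F i) (boundary ?F (Suc i))" for i
    using taylor_graded_map[where g = g and N = N and V = V and i = "Suc i", OF g] by (simp add: taylor_complex_def)
  show "map_image V (boundary ?F 0) = (\<lambda>p. vec 1 (\<lambda>_. p)) ` ?I"
  proof -
    have aug: "chain_vec N 0 (taylor_boundary g N c) =
        vec 1 (\<lambda>_. \<Sum>i<N. c {i} * Poly_Mapping.single (g i) 1)"
      for c :: "nat set \<Rightarrow> ('v, 'k) mpoly"
    proof -
      have "taylor_boundary g N c {} = (\<Sum>i<N. c {i} * Poly_Mapping.single (g i) 1)"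
        by (simp add: taylor_boundary_def position_sign_def mult.commute)
      then show ?thesis by (auto simp: chain_vec_def subset_list_0)
    qed
    have inj': "inj_on (\<lambda>i. Poly_Mapping.single (g i) (1::'k)) {..<N}"
    proof (rule inj_onI)
      fix i j assume ij: "i \<in> {..<N}" "j \<in> {..<N}"
        "Poly_Mapping.single (g i) (1::'k) = Poly_Mapping.single (g j) 1"
      have "{g i} = {g j}"
        using arg_cong[OF ij(3), of Poly_Mapping.keys] by simp
      then show "i = j" using inj ij(1,2) by (simp add: inj_on_eq_iff)
    qed
    have ideal: "?I = (\<lambda>c. \<Sum>i<N. c {i} * Poly_Mapping.single (g i) 1) `
       {c :: nat set \<Rightarrow> ('v, 'k::field) mpoly. (\<forall>\<sigma>. c \<sigma> \<in> poly_ring V) \<and> (\<forall>\<sigma>. card \<sigma> \<noteq> Suc 0 \<longrightarrow> c \<sigma> = 0)}"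
      (is "_ = ?f ` ?C")
    proof (intro equalityI subsetI)
      fix p assume "p \<in> ?I"
      then obtain A c where A: "A \<subseteq> (\<lambda>i. Poly_Mapping.single (g i) 1) ` {..<N}" "c ` A \<subseteq> poly_ring V"
          and p: "p = (\<Sum>b\<in>A. c b * b)"
        unfolding generated_ideal_def by auto
      define d where "d \<sigma> = (if card \<sigma> = 1 \<and> Poly_Mapping.single (g (the_elem \<sigma>)) 1 \<in> A
        then c (Poly_Mapping.single (g (the_elem \<sigma>)) 1) else 0)" for \<sigma> :: "nat set"
      have "p = (\<Sum>b\<in>(\<lambda>i. Poly_Mapping.single (g i) 1) ` {..<N}. if b \<in> A then c b * b else 0)"
        unfolding p using A(1) by (intro sum.mono_neutral_cong_left) auto
      also have "\<dots> = (\<Sum>i<N. d {i} * Poly_Mapping.single (g i) 1)"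
        by (subst sum.reindex[OF inj']) (auto simp: d_def intro!: sum.cong)
      finally have "p = ?f d" .
      moreover have "d \<in> ?C" using A(2) by (auto simp: d_def)
      ultimately show "p \<in> ?f ` ?C" by (rule image_eqI)
    next
      fix p assume "p \<in> ?f ` ?C"
      then obtain c where c: "\<And>\<sigma>. c \<sigma> \<in> poly_ring V" and p: "p = ?f c" by blast
      let ?m = "\<lambda>i. Poly_Mapping.single (g i) (1::'k)"
      define d where "d b = c {inv_into {..<N} ?m b}" for b
      have "p = (\<Sum>b\<in>?m ` {..<N}. d b * b)"
        unfolding p by (subst sum.reindex[OF inj']) (auto simp: d_def inv_into_f_f[OF inj'] intro!: sum.cong)
      then show "p \<in> ?I"
        unfolding generated_ideal_def using c
        by (intro CollectI exI[of _ "?m ` {..<N}"] exI[of _ d]) (simp add: d_def image_subset_iff)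
    qed
    show ?thesis unfolding taylor_map_image aug ideal image_image ..
  qed
  show "map_kernel V (boundary ?F i) = map_image V (boundary ?F (Suc i))" for i
  proof (intro equalityI subsetI)
    have dims: "dim_col (boundary ?F i) = length (subset_list N (Suc i))"
        "dim_row (boundary ?F i) = length (subset_list N i)"
      by (simp_all add: taylor_complex_def)
    have zero: "0\<^sub>v (length (subset_list N i)) = chain_vec N i (\<lambda>_. 0 :: ('v, 'k) mpoly)"
      by (auto simp: chain_vec_def)
    {
      fix f assume "f \<in> map_kernel V (boundary ?F i)"
      then have "f \<in> free_module V (length (subset_list N (Suc i)))"
          and 0: "boundary ?F i *\<^sub>v f = chain_vec N i (\<lambda>_. 0)"
        unfolding map_kernel_def dims zero by simp_all
      then obtain c where c: "\<And>\<sigma>. c \<sigma> \<in> poly_ring V" "\<And>\<sigma>. card \<sigma> \<noteq> Suc i \<Longrightarrow> c \<sigma> = 0"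
          and f: "f = chain_vec N (Suc i) c"
        unfolding free_module_eq_chains by blast
      have cyc: "chain_vec N i (taylor_boundary g N c) = chain_vec N i (\<lambda>_. 0)"
        using 0 unfolding f taylor_boundary_mat_mult .
      define b where "b \<sigma> = (if \<sigma> \<subseteq> {..<N} \<and> card \<sigma> = Suc (Suc i) then taylor_cone g N c \<sigma> else 0)" for \<sigma>
      have "taylor_boundary g N b \<tau> = c \<tau>" if \<tau>: "\<tau> \<subseteq> {..<N}" "card \<tau> = Suc i" for \<tau>
      proof -
        have fin: "finite \<tau>" using \<tau>(1) finite_subset by blast
        have "taylor_boundary g N b \<tau> = taylor_boundary g N (taylor_cone g N c) \<tau>"
          unfolding taylor_boundary_def using \<tau> fin by (intro sum.cong refl) (auto simp: b_def)
        also have "\<dots> = c \<tau>"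
        proof (rule taylor_boundary_cone[OF \<tau>(1)])
          show "\<tau> \<noteq> {}" using \<tau>(2) by auto
          show "c {} = 0" using c(2)[of "{}"] by simp
          fix j assume "j \<in> \<tau>"
          then have "card (\<tau> - {j}) = i" "\<tau> - {j} \<subseteq> {..<N}" using \<tau> fin by auto
          then show "taylor_boundary g N c (\<tau> - {j}) = 0" using cyc by (simp add: chain_vec_eq_iff)
        qed
        finally show ?thesis .
      qed
      then have "f = chain_vec N (Suc i) (taylor_boundary g N b)"
        unfolding f chain_vec_eq_iff by simp
      moreover have "b \<sigma> \<in> poly_ring V" for \<sigma>
        using taylor_cone_in_poly_ring[of \<sigma> c V] c(1) finite_subset[of \<sigma> "{..<N}"] by (auto simp: b_def)
      moreover have "card \<sigma> \<noteq> Suc (Suc i) \<Longrightarrow> b \<sigma> = 0" for \<sigma> by (auto simp: b_def)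
      ultimately show "f \<in> map_image V (boundary ?F (Suc i))"
        unfolding taylor_map_image by blast
    }
    {
      fix f assume f_im: "f \<in> map_image V (boundary ?F (Suc i))"
      then obtain c where c: "\<And>\<sigma>. c \<sigma> \<in> poly_ring V"
          and f: "f = chain_vec N (Suc i) (taylor_boundary g N c)"
        unfolding taylor_map_image by auto
      have "f \<in> free_module V (length (subset_list N (Suc i)))"
        using taylor_boundary_in_poly_ring[where g = g and N = N and V = V and c = c, OF g c] nth_subset_list[of _ N "Suc i"]
        by (auto simp: f chain_vec_def free_module_def)
      moreover have "boundary ?F i *\<^sub>v f = chain_vec N i (\<lambda>_. 0)"
        unfolding f taylor_boundary_mat_mult chain_vec_eq_iff by (simp add: taylor_boundary_boundary)
      ultimately show "f \<in> map_kernel V (boundary ?F i)"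
        unfolding map_kernel_def dims zero by simp
    }
  qed
qed

text \<open>The coefficients of the Taylor boundary are quotients of least common multiples, so they
  have no constant term if the least common multiple drops with every generator that is left out.\<close>

theorem taylor_resolution_minimal:
  assumes g: "\<And>i. i < N \<Longrightarrow> Poly_Mapping.keys (g i) \<subseteq> V"
    and strict: "\<And>\<sigma> j. \<sigma> \<subseteq> {..<N} \<Longrightarrow> j < N \<Longrightarrow> j \<notin> \<sigma> \<Longrightarrow>
      monomial_lcm g (insert j \<sigma>) \<noteq> monomial_lcm g \<sigma>"
  shows "minimal_graded_free_resolution V
    (generated_ideal V ((\<lambda>i. Poly_Mapping.single (g i) 1) ` {..<N}))
    (taylor_complex g N :: ('v, 'k::field) graded_complex)"
  unfolding minimal_graded_free_resolution_def
proof (intro conjI allI ballI impI)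
  have "inj_on g {..<N}"
  proof (rule inj_onI, rule ccontr)
    fix i j assume ij: "i \<in> {..<N}" "j \<in> {..<N}" "g i = g j" "i \<noteq> j"
    then have "monomial_lcm g {i, j} = monomial_lcm g {j}"
      by (intro poly_mapping_eqI) (simp add: lookup_monomial_lcm)
    then show False using strict[of "{j}" i] ij by simp
  qed
  then show "graded_free_resolution V
    (generated_ideal V ((\<lambda>i. Poly_Mapping.single (g i) 1) ` {..<N}))
    (taylor_complex g N :: ('v, 'k) graded_complex)"
    by (intro taylor_resolution g)
  fix i l and f :: "('v, 'k) mpoly vec"
  assume "f \<in> map_image V (boundary (taylor_complex g N) (Suc i))"
    and "l < length (shifts (taylor_complex g N :: ('v, 'k) graded_complex) i)"
  then obtain c where f: "f = chain_vec N (Suc i) (taylor_boundary g N c)"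
      and l: "l < length (subset_list N (Suc i))"
    unfolding taylor_map_image by (auto simp: taylor_complex_def)
  define \<tau> where "\<tau> = subset_list N (Suc i) ! l"
  have \<tau>: "\<tau> \<subseteq> {..<N}" "finite \<tau>"
    using nth_subset_list[OF l] finite_subset[of \<tau> "{..<N}"] by (auto simp: \<tau>_def)
  have "Poly_Mapping.lookup (Poly_Mapping.single (monomial_lcm g (insert j \<tau>) - monomial_lcm g \<tau>)
      (position_sign j \<tau>) * c (insert j \<tau>)) 0 = 0" if j: "j \<in> {..<N} - \<tau>" for j
  proof -
    have "monomial_lcm g (insert j \<tau>) - monomial_lcm g \<tau> \<noteq> 0"
      using strict[OF \<tau>(1)] j monomial_dvd_add_diff[OF monomial_lcm_mono[of "insert j \<tau>" \<tau> g]] \<tau>(2)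
      by (metis DiffD1 DiffD2 add.right_neutral finite_insert lessThan_iff subset_insertI)
    then show ?thesis by (simp add: constant_term_mult lookup_single when_def)
  qed
  then have "Poly_Mapping.lookup (taylor_boundary g N c \<tau>) 0 = 0"
    by (simp add: taylor_boundary_def lookup_sum)
  then show "Poly_Mapping.lookup (f $ l) 0 = 0"
    using l by (simp add: f chain_vec_def \<tau>_def)
qed

section \<open>Invariants of a monomial ideal with minimal Taylor resolution\<close>

text \<open>Every non-empty set of generators is a basis element of the minimal resolution. Adding a
  generator raises the homological degree by 1 and the degree of the least common multiple by at
  least 1, so both invariants are attained at the set of all generators.\<close>

theorem regularity_and_pd_of_strict_lcms:
  fixes V :: "'v set"
  assumes N: "1 \<le> N" and g: "\<And>i. i < N \<Longrightarrow> Poly_Mapping.keys (g i) \<subseteq> V"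
    and strict: "\<And>\<sigma> j. \<sigma> \<subseteq> {..<N} \<Longrightarrow> j < N \<Longrightarrow> j \<notin> \<sigma> \<Longrightarrow>
      monomial_lcm g (insert j \<sigma>) \<noteq> monomial_lcm g \<sigma>"
  defines "I \<equiv> generated_ideal V ((\<lambda>i. Poly_Mapping.single (g i) 1) ` {..<N}) :: ('v, 'k::field) mpoly set"
  shows "regularity V I = int (monomial_degree (monomial_lcm g {..<N})) - int N + 1"
    and "projective_dimension V I = N - 1"
proof -
  let ?deg = "\<lambda>\<sigma>. monomial_degree (monomial_lcm g \<sigma>)"
  have betti: "graded_betti V I i j \<noteq> 0 \<longleftrightarrow> (\<exists>\<sigma>. \<sigma> \<subseteq> {..<N} \<and> card \<sigma> = Suc i \<and> ?deg \<sigma> = j)" for i j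
  proof -
    have "graded_betti V I i j = count_list (map ?deg (subset_list N (Suc i))) j"
      using graded_betti_eq_count[OF taylor_resolution_minimal[where g = g and N = N and V = V, OF g strict], where ?'b = 'k]
      by (simp add: taylor_complex_def I_def)
    then show ?thesis
      by (auto simp: count_list_0_iff set_subset_list)
  qed
  have deg_less: "?deg \<sigma> < ?deg (insert j \<sigma>)" if "\<sigma> \<subseteq> {..<N}" "j < N" "j \<notin> \<sigma>" for \<sigma> j
  proof -
    have "finite \<sigma>" using that(1) finite_subset by blast
    define m where "m = monomial_lcm g (insert j \<sigma>) - monomial_lcm g \<sigma>"
    have m: "monomial_lcm g (insert j \<sigma>) = monomial_lcm g \<sigma> + m"
      unfolding m_def using \<open>finite \<sigma>\<close> by (intro monomial_dvd_add_diff[symmetric] monomial_lcm_mono) auto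
    then have "m \<noteq> 0" using strict[OF that] by auto
    then obtain v where "v \<in> Poly_Mapping.keys m" by (auto simp: poly_mapping_eq_iff fun_eq_iff in_keys_iff)
    then have "0 < monomial_degree m"
      unfolding monomial_degree_def by (intro sum_pos2[of _ v]) (auto simp: in_keys_iff)
    then show ?thesis by (simp add: m monomial_degree_add)
  qed
  have deg_bound: "?deg \<sigma> + k \<le> ?deg {..<N}" if "\<sigma> \<subseteq> {..<N}" "card ({..<N} - \<sigma>) = k" for \<sigma> k
    using that
  proof (induction k arbitrary: \<sigma>)
    case 0
    then have "\<sigma> = {..<N}" by auto
    then show ?case by simp
  next
    case (Suc k)
    then obtain j where j: "j < N" "j \<notin> \<sigma>"
    proof -
      have "{..<N} - \<sigma> \<noteq> {}" using Suc.prems(2) by (metis card.empty nat.distinct(1))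
      then show ?thesis using that by blast
    qed
    have "{..<N} - insert j \<sigma> = ({..<N} - \<sigma>) - {j}" by blast
    moreover have "card (({..<N} - \<sigma>) - {j}) = k"
      using Suc.prems(2) j by (subst card_Diff_singleton) auto
    ultimately have "card ({..<N} - insert j \<sigma>) = k" by simp
    then have "?deg (insert j \<sigma>) + k \<le> ?deg {..<N}"
      using Suc.IH Suc.prems(1) j by auto
    then show ?case using deg_less[OF Suc.prems(1) j] by linarith
  qed
  show "projective_dimension V I = N - 1"
    unfolding projective_dimension_def
  proof (rule Max_eqI)
    have bound: "i \<le> N - 1" if "i \<in> {i. \<exists>j. graded_betti V I i j \<noteq> 0}" for i
    proof -
      obtain \<sigma> where "\<sigma> \<subseteq> {..<N}" "card \<sigma> = Suc i" using \<open>i \<in> _\<close> unfolding betti by blast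
      then show ?thesis using card_mono[of "{..<N}" \<sigma>] by simp
    qed
    then have "{i. \<exists>j. graded_betti V I i j \<noteq> 0} \<subseteq> {..N - 1}" by blast
    then show "finite {i. \<exists>j. graded_betti V I i j \<noteq> 0}" by (rule finite_subset) simp
    show "i \<le> N - 1" if "i \<in> {i. \<exists>j. graded_betti V I i j \<noteq> 0}" for i
      by (rule bound[OF that])
    show "N - 1 \<in> {i. \<exists>j. graded_betti V I i j \<noteq> 0}"
      unfolding betti using N by (intro CollectI exI[of _ "?deg {..<N}"] exI[of _ "{..<N}"]) simp
  qed
  have eq: "{int j - int i | i j. graded_betti V I i j \<noteq> 0} =
      (\<lambda>\<sigma>. int (?deg \<sigma>) - int (card \<sigma>) + 1) ` {\<sigma>. \<sigma> \<subseteq> {..<N} \<and> \<sigma> \<noteq> {}}" (is "?S = ?T")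
  proof (intro equalityI subsetI)
    fix r assume "r \<in> ?S"
    then obtain i j where r: "r = int j - int i" and "graded_betti V I i j \<noteq> 0" by blast
    then obtain \<sigma> where "\<sigma> \<subseteq> {..<N}" "card \<sigma> = Suc i" "r = int (?deg \<sigma>) - int i"
      unfolding betti by blast
    then show "r \<in> ?T" by (intro image_eqI[of _ _ \<sigma>]) auto
  next
    fix r assume "r \<in> ?T"
    then obtain \<sigma> where \<sigma>: "\<sigma> \<subseteq> {..<N}" "\<sigma> \<noteq> {}" "r = int (?deg \<sigma>) - int (card \<sigma>) + 1" by blast
    then have "card \<sigma> \<noteq> 0" using finite_subset[of \<sigma> "{..<N}"] by auto
    then obtain i where "card \<sigma> = Suc i" using not0_implies_Suc by blast
    then show "r \<in> ?S"
      unfolding betti using \<sigma> by (intro CollectI exI[of _ i] exI[of _ "?deg \<sigma>"]) auto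
  qed
  show "regularity V I = int (?deg {..<N}) - int N + 1"
    unfolding regularity_def eq
  proof (rule Max_eqI)
    show "finite ?T" by simp
    show "int (?deg {..<N}) - int N + 1 \<in> ?T"
      using N by (intro image_eqI[of _ _ "{..<N}"]) (auto simp: lessThan_def Suc_le_eq)
    fix r assume "r \<in> ?T"
    then obtain \<sigma> where \<sigma>: "\<sigma> \<subseteq> {..<N}" "r = int (?deg \<sigma>) - int (card \<sigma>) + 1" by blast
    moreover have "card ({..<N} - \<sigma>) = N - card \<sigma>" "card \<sigma> \<le> N"
      using \<sigma>(1) card_mono[of "{..<N}" \<sigma>] finite_subset[of \<sigma> "{..<N}"] by (auto simp: card_Diff_subset)
    ultimately show "r \<le> int (?deg {..<N}) - int N + 1"
      using deg_bound[OF \<sigma>(1) refl] by simp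
  qed
qed

section \<open>Rooted trees\<close>

text \<open>If two paths from \<open>u\<close> to \<open>v\<close> start with different arcs, follow the first one until it meets
  the second one and go back along the second one. This closed walk visits no vertex twice, and it
  has length at least 3 because the two paths have different second vertices.\<close>

lemma (in pair_bidirected_digraph) apath_unique_if_acyclic:
  assumes acyclic: "\<not> (\<exists>p. cycle p \<and> 3 \<le> length p)"
    and "apath u p v" "apath u q v"
  shows "p = q"
  using assms(2,3)
proof (induction p arbitrary: u q)
  case Nil
  then have "u = v" by (simp add: apath_Nil_iff)
  then show ?case using Nil(2) apath_nonempty_ends[of u q v] by auto
next
  case (Cons e p)
  have "u \<noteq> v" using apath_nonempty_ends[OF Cons.prems(1)] by simp
  then obtain f q' where q: "q = f # q'"
    using Cons.prems(2) by (cases q) (auto simp: apath_Nil_iff)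
  have p: "e \<in> parcs G" "fst e = u" "apath (snd e) p v" "u \<notin> set (pawalk_verts (snd e) p)"
    using Cons.prems(1) by (auto simp: apath_Cons_iff)
  have q': "f \<in> parcs G" "fst f = u" "apath (snd f) q' v"
    using Cons.prems(2) unfolding q by (auto simp: apath_Cons_iff)
  show ?case
  proof (cases "snd e = snd f")
    case True
    then have "e = f" using p(2) q'(2) by (simp add: prod_eq_iff)
    then show ?thesis using Cons.IH[OF p(3)] q'(3) by (simp add: q)
  next
    case False
    let ?Z = "set (pawalk_verts u q)"
    have walks: "awalk (snd e) p v" "awalk u q v"
      using p(3) Cons.prems(2) by (auto simp: apath_def)
    then have ends: "v \<in> set (pawalk_verts (snd e) p)" "v \<in> ?Z"
      by (metis awalkE awalk_verts_non_Nil last_in_set)+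
    then obtain xs z ys where split: "pawalk_verts (snd e) p = xs @ z # ys"
        and z: "z \<in> ?Z" and xs: "\<forall>x\<in>set xs. x \<notin> ?Z"
      using split_list_first_prop[of "pawalk_verts (snd e) p" "\<lambda>x. x \<in> ?Z"] by blast
    have "pcas (snd e) p v" using walks(1) by blast
    then obtain p1 p2 where p1: "pcas (snd e) p1 z" "p = p1 @ p2"
        "pawalk_verts (snd e) p1 = xs @ [z]"
      using split by (rule awalk_decomp_verts)
    obtain q1 q2 where q1: "q = q1 @ q2" "awalk u q1 z" "awalk z q2 v"
      using awalk_decomp[OF walks(2) z] by blast
    have walk_p1: "awalk (snd e) p1 z"
      using walks(1) p1 by (auto simp: awalk_def)
    have "distinct (pawalk_verts u q)" using Cons.prems(2) by (simp add: apath_def)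
    moreover have "pawalk_verts u q = pawalk_verts u q1 @ tl (pawalk_verts z q2)"
      using awalk_verts_append[of u q1 q2 v] walks(2) q1 by simp
    ultimately have dist_q1: "distinct (pawalk_verts u q1)" and sub: "set (pawalk_verts u q1) \<subseteq> ?Z"
      by auto
    have last_q1: "last (pawalk_verts u q1) = z" using q1(2) by blast
    have verts_q1: "pawalk_verts u q1 = butlast (pawalk_verts u q1) @ [z]"
      using last_q1 append_butlast_last_id[OF awalk_verts_non_Nil[of u q1]] by simp
    define c where "c = e # p1 @ rev_path q1"
    have ret: "awalk z (rev_path q1) u" using q1(2) by simp
    have walk_c: "awalk u c u"
      unfolding c_def using p(1,2) awalk_appendI[OF walk_p1 ret] by (simp add: awalk_Cons_iff)
    have "tl (pawalk_verts u c) = pawalk_verts (snd e) (p1 @ rev_path q1)"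
      by (simp add: c_def)
    also have "\<dots> = pawalk_verts (snd e) p1 @ tl (pawalk_verts z (rev_path q1))"
      using awalk_verts_append[OF awalk_appendI[OF walk_p1 ret]] walk_p1 by simp
    also have "\<dots> = (xs @ [z]) @ rev (butlast (pawalk_verts u q1))"
      unfolding awalk_verts_rev_path[OF q1(2)] p1(3)
      by (subst verts_q1) simp
    finally have verts_c: "tl (pawalk_verts u c) = (xs @ [z]) @ rev (butlast (pawalk_verts u q1))" .
    have "distinct (xs @ [z])"
      using p(3) split by (auto simp: apath_def)
    moreover have "distinct (butlast (pawalk_verts u q1) @ [z])" using dist_q1 verts_q1 by metis
    moreover have "set (butlast (pawalk_verts u q1)) \<subseteq> ?Z" using sub in_set_butlastD by fast
    ultimately have "distinct (tl (pawalk_verts u c))"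
      unfolding verts_c using xs by auto
    then have "cycle c" unfolding cycle_def using walk_c by (auto simp: c_def)
    moreover have "3 \<le> length c"
    proof -
      have "z \<noteq> u" using p(4) split by auto
      then have "q1 \<noteq> []" using q1(2) by (auto simp: awalk_Nil_iff)
      have "length (rev_path r) = length r" for r :: "('a \<times> 'a) list" by (induction r) auto
      moreover have "2 \<le> length p1 + length q1"
      proof (cases p1)
        case Nil
        then have "z = snd e" using p1(1) by simp
        then have "q1 \<noteq> [f]" using q1(2) False by (auto simp: awalk_Cons_iff awalk_Nil_iff)
        then show ?thesis using \<open>q1 \<noteq> []\<close> q1(1) unfolding q by (cases q1; cases "tl q1") auto
      next
        case (Cons a l)
        then show ?thesis using \<open>q1 \<noteq> []\<close> by (cases q1) auto
      qed
      ultimately show ?thesis by (simp add: c_def)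
    qed
    ultimately show ?thesis using acyclic by blast
  qed
qed

lemma parcs_underlying: "(u, v) \<in> parcs (mk_symmetric (with_proj G)) \<longleftrightarrow> (u, v) \<in> parcs G \<or> (v, u) \<in> parcs G"
  by (auto simp: parcs_mk_symmetric) (metis fst_conv snd_conv)

lemma (in weighted_oriented_graph) underlying_bidirected:
  "pair_bidirected_digraph (mk_symmetric (with_proj G))"
proof -
  interpret H: pair_digraph "mk_symmetric (with_proj G)" by (rule digraph_mk_symmetric)
  show ?thesis by unfold_locales (rule symmetric_mk_symmetric)
qed

context weighted_oriented_graph
begin

interpretation H: pair_bidirected_digraph "mk_symmetric (with_proj G)"
  by (rule underlying_bidirected)

lemma rooted_tree_apath_unique:
  assumes "rooted_tree G r" "H.apath u p v" "H.apath u q v"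
  shows "p = q"
  using H.apath_unique_if_acyclic[OF _ assms(2,3)] assms(1)
  by (simp add: rooted_tree_def oriented_tree_def)

lemma rooted_tree_arc_path:
  assumes "rooted_tree G r" "(u, v) \<in> parcs G"
  obtains p where "H.apath r (p @ [(u, v)]) v"
  using assms unfolding rooted_tree_def by blast

lemma rooted_tree_no_arc_to_root:
  assumes "rooted_tree G r"
  shows "(u, r) \<notin> parcs G"
proof
  assume "(u, r) \<in> parcs G"
  then obtain p where "H.apath r (p @ [(u, r)]) r" using rooted_tree_arc_path[OF assms] by blast
  then show False using H.apath_nonempty_ends by blast
qed

lemma rooted_tree_parent_unique:
  assumes "rooted_tree G r" "(u, v) \<in> parcs G" "(u', v) \<in> parcs G"
  shows "u = u'"
proof -
  obtain p p' where "H.apath r (p @ [(u, v)]) v" "H.apath r (p' @ [(u', v)]) v"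
    using rooted_tree_arc_path[OF assms(1)] assms(2,3) by metis
  then have "p @ [(u, v)] = p' @ [(u', v)]" by (rule rooted_tree_apath_unique[OF assms(1)])
  then show ?thesis by simp
qed

text \<open>The path from the root to \<open>v\<close> enters \<open>v\<close> from a neighbour \<open>u\<close>. If the arc between them were
  \<open>(v, u)\<close>, the path to \<open>u\<close> that ends in this arc would contain a second path to \<open>v\<close>, one that
  avoids \<open>u\<close>.\<close>

lemma rooted_tree_parent_exists:
  assumes tree: "rooted_tree G r" and v: "v \<in> pverts G" "v \<noteq> r"
  shows "\<exists>u. (u, v) \<in> parcs G"
proof -
  have "r \<in> pverts G" "strongly_connected (with_proj (mk_symmetric (with_proj G)))"
    using tree by (auto simp: rooted_tree_def oriented_tree_def connected_def)
  then have "r \<rightarrow>\<^sup>*\<^bsub>with_proj (mk_symmetric (with_proj G))\<^esub> v"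
    using v(1) by (auto simp: strongly_connected_def)
  then obtain p where p: "H.apath r p v" using H.reachable_apath by blast
  then have "p \<noteq> []" using v(2) by (auto simp: H.apath_Nil_iff)
  then obtain p0 u v' where p0: "p = p0 @ [(u, v')]" by (metis rev_exhaust surj_pair)
  have "v' = v" and arc: "(u, v) \<in> parcs (mk_symmetric (with_proj G))"
    using p unfolding p0 by (auto simp: H.apath_append_iff H.apath_Cons_iff H.apath_Nil_iff)
  show ?thesis
  proof (rule ccontr)
    assume no: "\<nexists>u. (u, v) \<in> parcs G"
    then have "(v, u) \<in> parcs G" using arc by (auto simp: parcs_underlying)
    then obtain p2 where p2: "H.apath r (p2 @ [(v, u)]) u" using rooted_tree_arc_path[OF tree] by blast
    then have "H.apath r p2 v" "u \<notin> set (pawalk_verts r p2)"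
      by (auto simp: H.apath_append_iff H.apath_Cons_iff H.apath_Nil_iff)
    moreover have "u \<in> set (pawalk_verts r p)"
      unfolding p0 by (rule H.awalk_verts_arc1[of "(u, v')", simplified]) simp
    ultimately show False using rooted_tree_apath_unique[OF tree p] by blast
  qed
qed

text \<open>The two neighbours differ, as the graph has no arcs in opposite directions.\<close>

lemma two_neighbours_degree:
  assumes "(u, v) \<in> parcs G" "(v, t) \<in> parcs G"
  shows "vertex_degree G v \<noteq> 1"
proof -
  have "u \<noteq> t" using assms oriented by blast
  have "{(v, u), (v, t)} \<subseteq> out_arcs (underlying G) v"
    using assms by (auto simp: out_arcs_def parcs_underlying)
  moreover have "finite (out_arcs (underlying G) v)"
    unfolding out_arcs_def using finite_arcs
    by (auto simp: parcs_mk_symmetric intro: finite_subset[of _ "parcs G \<union> (parcs G)\<inverse>"])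
  ultimately have "card {(v, u), (v, t)} \<le> vertex_degree G v"
    unfolding vertex_degree_def out_degree_def by (intro card_mono)
  then show ?thesis using \<open>u \<noteq> t\<close> by simp
qed

end

section \<open>Edge ideals of graphs in which every vertex has one incoming arc\<close>

lemma var_power: "(var v :: ('v, 'k::field) mpoly) ^ k = Poly_Mapping.single (Poly_Mapping.single v k) 1"
  by (induction k) (simp_all add: var_def mult_single flip: single_add)

text \<open>The generator of the arc into \<open>v\<close> is the only one in which \<open>v\<close> has exponent \<open>w v\<close>: in the
  others it occurs at most as a tail, with exponent 1, and tails have weight at least 2. So least
  common multiples drop strictly when a generator is left out.\<close>

theorem regularity_and_pd_if_unique_parents:
  fixes D :: "'v pair_pre_digraph" and w :: "'v \<Rightarrow> nat"
  assumes fin: "finite (pverts D)" and ne: "pverts D \<noteq> {}"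
    and arcs: "\<And>u v. (u, v) \<in> parcs D \<Longrightarrow> u \<in> pverts D \<and> v \<in> pverts D \<and> u \<noteq> v"
    and parent: "\<And>v. v \<in> pverts D \<Longrightarrow> \<exists>!u. (u, v) \<in> parcs D"
    and pos: "\<And>v. v \<in> pverts D \<Longrightarrow> 1 \<le> w v"
    and w2: "\<And>u v. (u, v) \<in> parcs D \<Longrightarrow> 2 \<le> w u"
  shows "regularity (pverts D) (edge_ideal D w :: ('v, 'k::field) mpoly set) =
      int (\<Sum>v\<in>pverts D. w v) - int (card (parcs D)) + 1"
    and "projective_dimension (pverts D) (edge_ideal D w :: ('v, 'k::field) mpoly set) =
      card (parcs D) - 1"
proof -
  let ?V = "pverts D"
  define N where "N = card ?V"
  obtain h where h: "bij_betw h {..<N} ?V"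
    using ex_bij_betw_nat_finite[OF fin] unfolding N_def atLeast0LessThan by blast
  have h_in: "h i \<in> ?V" if "i < N" for i using h that by (auto simp: bij_betw_def)
  have h_eq: "h i = h j \<longleftrightarrow> i = j" if "i < N" "j < N" for i j
    using h that by (auto simp: bij_betw_def inj_on_def)
  define p where "p v = (THE u. (u, v) \<in> parcs D)" for v
  have p: "(u, v) \<in> parcs D \<longleftrightarrow> v \<in> ?V \<and> u = p v" for u v
    using parent[of v] arcs[of u v] unfolding p_def by (metis theI')
  have card_arcs: "card (parcs D) = N"
  proof -
    have "parcs D = (\<lambda>v. (p v, v)) ` ?V" using p by (auto simp: image_iff)
    then show ?thesis by (simp add: card_image inj_on_def N_def)
  qed
  have N: "1 \<le> N" using fin ne by (simp add: N_def Suc_le_eq card_gt_0_iff)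
  define g where "g i = Poly_Mapping.single (p (h i)) 1 + Poly_Mapping.single (h i) (w (h i))" for i
  have p_in: "p v \<in> ?V" "p v \<noteq> v" "2 \<le> w (p v)" if "v \<in> ?V" for v
    using p[of "p v" v] arcs[of "p v" v] w2[of "p v" v] that by auto
  have g_same: "Poly_Mapping.lookup (g i) (h i) = w (h i)" if "i < N" for i
    using p_in(2)[OF h_in[OF that]] by (simp add: g_def lookup_add lookup_single)
  \<comment> \<open>A vertex occurs in the generator of another arc only as its tail, hence with exponent 1,
    and then its weight is at least 2.\<close>
  have g_other: "Poly_Mapping.lookup (g i) (h j) < w (h j)" if "i < N" "j < N" "i \<noteq> j" for i j
    using p_in(3)[OF h_in[OF that(1)]] pos[OF h_in[OF that(2)]] that h_eq[OF that(1,2)]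
    by (auto simp: g_def lookup_add lookup_single when_def)
  have keys_g: "Poly_Mapping.keys (g i) \<subseteq> ?V" if "i < N" for i
    using p_in(1)[OF h_in[OF that]] h_in[OF that] by (auto simp: g_def keys_add_monomial split: if_splits)
  have strict: "monomial_lcm g (insert j \<sigma>) \<noteq> monomial_lcm g \<sigma>"
    if \<sigma>: "\<sigma> \<subseteq> {..<N}" and j: "j < N" "j \<notin> \<sigma>" for \<sigma> j
  proof -
    have fin_\<sigma>: "finite \<sigma>" using \<sigma> finite_subset by blast
    have "Poly_Mapping.lookup (monomial_lcm g \<sigma>) (h j) < w (h j)"
      unfolding lookup_monomial_lcm[OF fin_\<sigma>]
      using fin_\<sigma> g_other[of _ j] \<sigma> j pos[OF h_in[OF j(1)]] by (subst Max_less_iff) auto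
    also have "w (h j) \<le> Poly_Mapping.lookup (monomial_lcm g (insert j \<sigma>)) (h j)"
      using dvd_monomial_lcm[of "insert j \<sigma>" j g] fin_\<sigma> g_same[OF j(1)]
      by (metis finite_insert insertI1 monomial_dvd_def)
    finally show ?thesis by auto
  qed
  have lcm: "Poly_Mapping.lookup (monomial_lcm g {..<N}) v = w v" if "v \<in> ?V" for v
  proof -
    have "v \<in> h ` {..<N}" using h that by (simp add: bij_betw_def)
    then obtain j where j: "j < N" "v = h j" by blast
    have "Poly_Mapping.lookup (g i) v \<le> w v" if "i < N" for i
      using g_same[of i] g_other[of i j] that j by (cases "i = j") auto
    then have "Max (insert 0 ((\<lambda>i. Poly_Mapping.lookup (g i) v) ` {..<N})) = w v"
      using j g_same[OF j(1)] by (intro Max_eqI) (auto intro!: image_eqI[of _ _ j])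
    then show ?thesis by (simp add: lookup_monomial_lcm)
  qed
  have degree: "monomial_degree (monomial_lcm g {..<N}) = (\<Sum>v\<in>?V. w v)"
    using monomial_degree_eq_sum[OF fin keys_monomial_lcm[of "{..<N}" g]] keys_g lcm by simp
  have ideal: "(edge_ideal D w :: ('v, 'k) mpoly set) =
      generated_ideal ?V ((\<lambda>i. Poly_Mapping.single (g i) 1) ` {..<N})"
  proof -
    have gen: "var (p (h i)) * var (h i) ^ w (h i) = (Poly_Mapping.single (g i) 1 :: ('v, 'k) mpoly)" for i
      unfolding var_power by (simp add: g_def var_def mult_single)
    have "{var a * var b ^ w b | a b. (a, b) \<in> parcs D} = (\<lambda>v. var (p v) * var v ^ w v) ` h ` {..<N}"
      using h by (auto simp: p bij_betw_def)
    also have "\<dots> = (\<lambda>i. Poly_Mapping.single (g i) 1 :: ('v, 'k) mpoly) ` {..<N}"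
      unfolding image_image gen ..
    finally show ?thesis unfolding edge_ideal_def by simp
  qed
  note result = regularity_and_pd_of_strict_lcms[where g = g and N = N and V = ?V and ?'k = 'k,
      OF N keys_g strict]
  show "regularity ?V (edge_ideal D w :: ('v, 'k) mpoly set) =
      int (\<Sum>v\<in>?V. w v) - int (card (parcs D)) + 1"
    unfolding ideal card_arcs degree[symmetric] by (rule result(1))
  show "projective_dimension ?V (edge_ideal D w :: ('v, 'k) mpoly set) = card (parcs D) - 1"
    unfolding ideal card_arcs by (rule result(2))
qed

section \<open>Oriented cycles with rooted trees attached\<close>

theorem theorem1p1:
  fixes C D :: "'v pair_pre_digraph" and T :: "nat \<Rightarrow> 'v pair_pre_digraph"
    and wC w :: "'v \<Rightarrow> nat" and wT :: "nat \<Rightarrow> 'v \<Rightarrow> nat"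
    and x rt :: "nat \<Rightarrow> 'v" and idx :: "nat \<Rightarrow> nat" and n s :: nat
  assumes n: "3 \<le> n"
    and C_graph: "weighted_oriented_graph C wC"
    and x_inj: "inj_on x {1..n}"
    and C_verts: "pverts C = x ` {1..n}"
    and C_arcs: "parcs C = insert (x n, x 1) {(x i, x (i + 1)) | i. 1 \<le> i \<and> i < n}"
    and C_weight: "\<And>i. i \<in> {1..n} \<Longrightarrow> 2 \<le> wC (x i)"
    and s: "1 \<le> s"
    and T_graph: "\<And>j. j \<in> {1..s} \<Longrightarrow> weighted_oriented_graph (T j) (wT j)"
    and T_tree: "\<And>j. j \<in> {1..s} \<Longrightarrow> rooted_tree (T j) (rt j)"
    and T_weight: "\<And>j v. j \<in> {1..s} \<Longrightarrow> v \<in> pverts (T j) \<Longrightarrow> v \<noteq> rt j \<Longrightarrow>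
                     vertex_degree (T j) v \<noteq> 1 \<Longrightarrow> 2 \<le> wT j v"
    and idx_range: "idx ` {1..s} \<subseteq> {1..n}"
    and idx_mono: "strict_mono_on {1..s} idx"
    and root_attached: "\<And>j. j \<in> {1..s} \<Longrightarrow> rt j = x (idx j)"
    and T_C_disjoint: "\<And>j. j \<in> {1..s} \<Longrightarrow> pverts (T j) \<inter> pverts C = {rt j}"
    and T_disjoint: "\<And>j k. j \<in> {1..s} \<Longrightarrow> k \<in> {1..s} \<Longrightarrow> j \<noteq> k \<Longrightarrow>
                       pverts (T j) \<inter> pverts (T k) = {}"
    and D_verts: "pverts D = pverts C \<union> (\<Union>j\<in>{1..s}. pverts (T j))"
    and D_arcs: "parcs D = parcs C \<union> (\<Union>j\<in>{1..s}. parcs (T j))"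
    and w_C: "\<And>v. v \<in> pverts C \<Longrightarrow> w v = wC v"
    and w_T: "\<And>j v. j \<in> {1..s} \<Longrightarrow> v \<in> pverts (T j) \<Longrightarrow> v \<noteq> rt j \<Longrightarrow> w v = wT j v"
  shows "regularity (pverts D) (edge_ideal D w :: ('v, 'k::field) mpoly set) =
           int (\<Sum>v\<in>pverts D. w v) - int (card (parcs D)) + 1 \<and>
         projective_dimension (pverts D) (edge_ideal D w :: ('v, 'k::field) mpoly set) =
           card (parcs D) - 1"
proof -
  interpret C: weighted_oriented_graph C wC by (rule C_graph)
  have arcs_C: "(u, v) \<in> parcs C \<Longrightarrow> u \<in> pverts C \<and> v \<in> pverts C \<and> u \<noteq> v" for u v
    using C.in_arcsD1[of u v] C.in_arcsD2[of u v] C.no_loops'[of u v] by simp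
  have arcs_T: "(u, v) \<in> parcs (T j) \<Longrightarrow> u \<in> pverts (T j) \<and> v \<in> pverts (T j) \<and> u \<noteq> v \<and> v \<noteq> rt j"
    if j: "j \<in> {1..s}" for u v j
  proof -
    interpret T: weighted_oriented_graph "T j" "wT j" by (rule T_graph[OF j])
    assume uv: "(u, v) \<in> parcs (T j)"
    then show ?thesis
      using T.in_arcsD1[OF uv] T.in_arcsD2[OF uv] T.no_loops'[OF uv]
        T.rooted_tree_no_arc_to_root[OF T_tree[OF j], of u] by auto
  qed
  have parent_C: "\<exists>!u. (u, v) \<in> parcs C" if "v \<in> pverts C" for v
  proof -
    have "v \<in> x ` {1..n}" using that by (simp only: C_verts)
    then obtain i where i: "i \<in> {1..n}" "v = x i" by blast
    have x_eq: "x a = x b \<longleftrightarrow> a = b" if "a \<in> {1..n}" "b \<in> {1..n}" for a b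
      by (rule inj_on_eq_iff[OF x_inj that])
    let ?path = "{(x k, x (k + 1)) | k. 1 \<le> k \<and> k < n}"
    have "(u, v) \<in> parcs C \<longleftrightarrow> u = x (if i = 1 then n else i - 1)" for u
    proof (cases "i = 1")
      case True
      have "(u, x 1) \<notin> ?path"
      proof
        assume "(u, x 1) \<in> ?path"
        then obtain k where "1 \<le> k" "k < n" "x (k + 1) = x 1" by auto
        then show False using x_eq[of "k + 1" 1] by simp
      qed
      then show ?thesis
        unfolding i(2) C_arcs True by (simp only: insert_iff prod.inject if_True refl simp_thms)
    next
      case False
      have "(u, x i) \<in> ?path \<longleftrightarrow> u = x (i - 1)"
      proof
        assume "(u, x i) \<in> ?path"
        then obtain k where k: "1 \<le> k" "k < n" "u = x k" "x (k + 1) = x i" by auto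
        then show "u = x (i - 1)" using x_eq[of "k + 1" i] i(1) by auto
      next
        assume "u = x (i - 1)"
        then show "(u, x i) \<in> ?path" using i(1) False by (intro CollectI exI[of _ "i - 1"]) auto
      qed
      moreover have "x i \<noteq> x 1" using x_eq[of i 1] i(1) n False by auto
      ultimately show ?thesis using False i(2) by (simp add: C_arcs)
    qed
    then show ?thesis by simp
  qed
  have parent_T: "\<exists>!u. (u, v) \<in> parcs (T j)" if "j \<in> {1..s}" "v \<in> pverts (T j)" "v \<noteq> rt j" for j v
  proof -
    interpret T: weighted_oriented_graph "T j" "wT j" by (rule T_graph[OF that(1)])
    show ?thesis
      using T.rooted_tree_parent_exists[OF T_tree[OF that(1)] that(2,3)]
        T.rooted_tree_parent_unique[OF T_tree[OF that(1)]] by blast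
  qed
  have vertex_cases: "v \<in> pverts C \<or> (\<exists>j\<in>{1..s}. v \<in> pverts (T j) \<and> v \<noteq> rt j \<and> v \<notin> pverts C)"
    if "v \<in> pverts D" for v
    using that T_C_disjoint unfolding D_verts by blast
  \<comment> \<open>An arc of a tree does not end in its root, which is the only vertex of the tree on the cycle.\<close>
  have in_arc_C: "(u, v) \<in> parcs D \<longleftrightarrow> (u, v) \<in> parcs C" if "v \<in> pverts C" for u v
    using that arcs_T T_C_disjoint unfolding D_arcs by blast
  have arc_T: "(u, v) \<in> parcs D \<longleftrightarrow> (u, v) \<in> parcs (T j)"
    if "j \<in> {1..s}" "t \<in> pverts (T j)" "t \<notin> pverts C" "t = u \<or> t = v" for j t u v
    using that arcs_T arcs_C T_disjoint[of j] unfolding D_arcs by blast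
  have finite_D: "finite (pverts D)"
  proof -
    have "finite (pverts (T j))" if "j \<in> {1..s}" for j
    proof -
      interpret T: weighted_oriented_graph "T j" "wT j" by (rule T_graph[OF that])
      show ?thesis by (rule T.pair_finite_verts)
    qed
    then show ?thesis unfolding D_verts using C.pair_finite_verts by blast
  qed
  have arcs: "u \<in> pverts D \<and> v \<in> pverts D \<and> u \<noteq> v" if "(u, v) \<in> parcs D" for u v
    using that arcs_C arcs_T unfolding D_arcs D_verts by blast
  have parent: "\<exists>!u. (u, v) \<in> parcs D" if "v \<in> pverts D" for v
    using vertex_cases[OF that]
  proof
    assume "v \<in> pverts C"
    then show ?thesis using parent_C in_arc_C by simp
  next
    assume "\<exists>j\<in>{1..s}. v \<in> pverts (T j) \<and> v \<noteq> rt j \<and> v \<notin> pverts C"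
    then obtain j where j: "j \<in> {1..s}" "v \<in> pverts (T j)" "v \<noteq> rt j" "v \<notin> pverts C" by blast
    then show ?thesis using parent_T[OF j(1-3)] arc_T[OF j(1,2,4)] by simp
  qed
  have C_w: "2 \<le> w v" if "v \<in> pverts C" for v
    using that C_weight w_C[OF that] unfolding C_verts by auto
  have pos: "1 \<le> w v" if "v \<in> pverts D" for v
    using vertex_cases[OF that]
  proof
    assume "v \<in> pverts C"
    then show ?thesis using C_w by fastforce
  next
    assume "\<exists>j\<in>{1..s}. v \<in> pverts (T j) \<and> v \<noteq> rt j \<and> v \<notin> pverts C"
    then obtain j where j: "j \<in> {1..s}" "v \<in> pverts (T j)" "v \<noteq> rt j" by blast
    interpret T: weighted_oriented_graph "T j" "wT j" by (rule T_graph[OF j(1)])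
    show ?thesis using T.weight_pos[OF j(2)] w_T[OF j] by simp
  qed
  have w2: "2 \<le> w u" if uv: "(u, v) \<in> parcs D" for u v
  proof -
    have "u \<in> pverts D" using arcs[OF uv] by blast
    from vertex_cases[OF this] show ?thesis
    proof
      assume "u \<in> pverts C"
      then show ?thesis by (rule C_w)
    next
      assume "\<exists>j\<in>{1..s}. u \<in> pverts (T j) \<and> u \<noteq> rt j \<and> u \<notin> pverts C"
      then obtain j where j: "j \<in> {1..s}" "u \<in> pverts (T j)" "u \<noteq> rt j" "u \<notin> pverts C" by blast
      interpret T: weighted_oriented_graph "T j" "wT j" by (rule T_graph[OF j(1)])
      have "(u, v) \<in> parcs (T j)" using arc_T[OF j(1,2,4)] uv by simp
      \<comment> \<open>With a parent and the child \<open>v\<close>, the vertex \<open>u\<close> is not a leaf of its tree.\<close>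
      moreover obtain t where "(t, u) \<in> parcs (T j)" using parent_T[OF j(1-3)] by blast
      ultimately have "vertex_degree (T j) u \<noteq> 1" by (rule T.two_neighbours_degree[rotated])
      then show ?thesis using T_weight[OF j(1-3)] w_T[OF j(1-3)] by simp
    qed
  qed
  have "pverts D \<noteq> {}" using n unfolding D_verts C_verts by auto
  from regularity_and_pd_if_unique_parents[where D = D and w = w and ?'k = 'k,
      OF finite_D this arcs parent pos w2]
  show ?thesis by simp
qed

end
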